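(* A monounary algebra is ultrahomogeneous if and only if it is isomorphic to $$\beta\cdot\mathcal{B}_\alpha+\sum_{k\in\mathbb{N}}\beta_k\cdot\mathcal{A}[n_k;\alpha_0^k,\alpha_1^k,\dots]$$ for some distinct $n_1,n_2,\dots\in\mathbb{N}$, some cardinals $\beta,\beta_k$ $(k\in\mathbb{N})$ (possibly zero), some nonzero cardinal $\alpha$, and, for each $k\in\mathbb{N}$, some (possibly finite, possibly empty) countable list of nonzero cardinals $\alpha_0^k,\alpha_1^k,\dots$.
   Context: A monounary algebra is a pair $\mathcal{A}=(A;\theta)$ where $A$ is a nonempty set (of arbitrary cardinality) and $\theta\colon A\to A$. It is connected if for all $x,y\in A$ there are $n,m\geq 0$ with $\theta^n(x)=\theta^m(y)$. Subalgebras are nonempty subsets closed under $\theta$; isomorphisms are bijections commuting with the operations. $\mathcal{A}$ is ultrahomogeneous if every isomorphism between finitely generated subalgebras of $\mathcal{A}$ extends to an automorphism of $\mathcal{A}$. $\mathbb{N}=\{1,2,\dots\}$. Sums $+,\sum$ denote disjoint unions of monounary algebras, and for a cardinal $\beta$, $\beta\cdot\mathcal{C}$ is the disjoint union of $\beta$ copies of $\mathcal{C}$ (empty if $\beta=0$). An element $x$ is cyclic if $\theta^n(x)=x$ for some $n\in\mathbb{N}$. The height $\mathrm{ht}(x)$ is the least $n\geq 0$ with $\theta^n(x)$ cyclic ($\infty$ if there is none). For a cardinal $\alpha>0$, $\mathcal{B}_\alpha$ denotes the (unique up to isomorphism) connected monounary algebra without cyclic elements in which $|\theta^{-1}(x)|=\alpha$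 for every element $x$. For $n\in\mathbb{N}$ and a (possibly finite) countable list $\alpha_0,\alpha_1,\dots$ of nonzero cardinals, $\mathcal{A}[n;\alpha_0,\alpha_1,\dots]$ denotes the (unique up to isomorphism) connected monounary algebra whose set $C$ of cyclic elements has size $n$, with $|\theta^{-1}(c)\setminus C|=\alpha_0$ for each $c\in C$, and $|\theta^{-1}(x)|=\alpha_k$ for every $x$ with $\mathrm{ht}(x)=k>0$. If the list is finite, missing entries are read as $0$ (so with list $\alpha_0,\dots,\alpha_h$ the elements of height $h+1$ have no preimages, and with the empty list the algebra is just an $n$-cycle). *)

theory Defs
  imports "HOL.Hull" "HOL-Library.Extended_Nat"
begin

unbundle cardinal_syntax

section \<open>Monounary algebras\<close>

text \<open>
  The operation is a total function on the ambient type; only its restriction to the carrier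
  is relevant.
\<close>

record 'a monounary =
  carrier :: "'a set"
  oper :: "'a \<Rightarrow> 'a"

definition monounary_algebra :: "'a monounary \<Rightarrow> bool" where
  "monounary_algebra M \<longleftrightarrow> carrier M \<noteq> {} \<and> oper M ` carrier M \<subseteq> carrier M"

definition connected_algebra :: "'a monounary \<Rightarrow> bool" where
  "connected_algebra M \<longleftrightarrow>
     (\<forall>x\<in>carrier M. \<forall>y\<in>carrier M. \<exists>n m. (oper M ^^ n) x = (oper M ^^ m) y)"

definition subalgebra :: "'a monounary \<Rightarrow> 'a set \<Rightarrow> bool" where
  "subalgebra M S \<longleftrightarrow> S \<noteq> {} \<and> S \<subseteq> carrier M \<and> oper M ` S \<subseteq> S"

abbreviation restrict_algebra :: "'a monounary \<Rightarrow> 'a set \<Rightarrow> 'a monounary" where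
  "restrict_algebra M S \<equiv> M\<lparr>carrier := S\<rparr>"

text \<open>The generating set is nonempty because subalgebras are nonempty.\<close>

definition fin_gen_subalgebra :: "'a monounary \<Rightarrow> 'a set \<Rightarrow> bool" where
  "fin_gen_subalgebra M S \<longleftrightarrow>
     (\<exists>X. finite X \<and> X \<noteq> {} \<and> X \<subseteq> carrier M \<and> S = subalgebra M hull X)"

definition isomorphism :: "'a monounary \<Rightarrow> 'b monounary \<Rightarrow> ('a \<Rightarrow> 'b) \<Rightarrow> bool" where
  "isomorphism M N f \<longleftrightarrow>
     bij_betw f (carrier M) (carrier N) \<and> (\<forall>x\<in>carrier M. f (oper M x) = oper N (f x))"

definition isomorphic :: "'a monounary \<Rightarrow> 'b monounary \<Rightarrow> bool" where
  "isomorphic M N \<longleftrightarrow> (\<exists>f. isomorphism M N f)"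

definition ultrahomogeneous :: "'a monounary \<Rightarrow> bool" where
  "ultrahomogeneous M \<longleftrightarrow>
     (\<forall>S T f. fin_gen_subalgebra M S \<longrightarrow> fin_gen_subalgebra M T \<longrightarrow>
        isomorphism (restrict_algebra M S) (restrict_algebra M T) f \<longrightarrow>
        (\<exists>g. isomorphism M M g \<and> (\<forall>x\<in>S. g x = f x)))"


section \<open>Disjoint unions\<close>

definition binary_sum :: "'a monounary \<Rightarrow> 'b monounary \<Rightarrow> ('a + 'b) monounary"
    (infixl \<open>\<oplus>\<close> 65) where
  "M \<oplus> N = \<lparr>carrier = carrier M <+> carrier N, oper = map_sum (oper M) (oper N)\<rparr>"

definition indexed_sum :: "'i set \<Rightarrow> ('i \<Rightarrow> 'a monounary) \<Rightarrow> ('i \<times> 'a) monounary" where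
  "indexed_sum I M =
     \<lparr>carrier = (SIGMA i:I. carrier (M i)), oper = (\<lambda>(i, x). (i, oper (M i) x))\<rparr>"

text \<open>
  Cardinals are cardinal orders in the sense of \<^const>\<open>Card_order\<close>; a cardinal is zero iff its
  field is empty.  The copies are indexed by the field.
\<close>

definition copies :: "'c rel \<Rightarrow> 'a monounary \<Rightarrow> ('c \<times> 'a) monounary" (infixr \<open>\<odot>\<close> 70) where
  "\<beta> \<odot> M = indexed_sum (Field \<beta>) (\<lambda>_. M)"

definition nonzero_cardinal :: "'c rel \<Rightarrow> bool" where
  "nonzero_cardinal \<alpha> \<longleftrightarrow> Card_order \<alpha> \<and> Field \<alpha> \<noteq> {}"

text \<open>
  A possibly finite, possibly empty, countable list of nonzero cardinals: \<open>L\<close> is its length, and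
  the entries beyond its end are \<open>0\<close>.
\<close>

definition nonzero_cardinal_list :: "(nat \<Rightarrow> 'c rel) \<Rightarrow> bool" where
  "nonzero_cardinal_list \<alpha>s \<longleftrightarrow>
     (\<exists>L::enat. \<forall>k. if enat k < L then nonzero_cardinal (\<alpha>s k)
                   else Card_order (\<alpha>s k) \<and> Field (\<alpha>s k) = {})"


section \<open>Cyclic elements, height, and the algebras \<open>\<B>\<^sub>\<alpha>\<close> and \<open>\<A>[n; \<alpha>\<^sub>0, \<alpha>\<^sub>1, \<dots>]\<close>\<close>

definition cyclic_elements :: "'a monounary \<Rightarrow> 'a set" where
  "cyclic_elements M = {x \<in> carrier M. \<exists>n\<ge>1. (oper M ^^ n) x = x}"

definition height :: "'a monounary \<Rightarrow> 'a \<Rightarrow> enat" where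
  "height M x =
     (if \<exists>n. (oper M ^^ n) x \<in> cyclic_elements M
      then enat (LEAST n. (oper M ^^ n) x \<in> cyclic_elements M) else \<infinity>)"

definition preimages :: "'a monounary \<Rightarrow> 'a \<Rightarrow> 'a set" where
  "preimages M x = {y \<in> carrier M. oper M y = x}"

definition is_B :: "'c rel \<Rightarrow> 'a monounary \<Rightarrow> bool" where
  "is_B \<alpha> M \<longleftrightarrow> monounary_algebra M \<and> connected_algebra M \<and> cyclic_elements M = {} \<and>
     (\<forall>x\<in>carrier M. |preimages M x| =o \<alpha>)"

definition is_A :: "nat \<Rightarrow> (nat \<Rightarrow> 'c rel) \<Rightarrow> 'a monounary \<Rightarrow> bool" where
  "is_A n \<alpha>s M \<longleftrightarrow> monounary_algebra M \<and> connected_algebra M \<and>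
     finite (cyclic_elements M) \<and> card (cyclic_elements M) = n \<and>
     (\<forall>c\<in>cyclic_elements M. |preimages M c - cyclic_elements M| =o \<alpha>s 0) \<and>
     (\<forall>x\<in>carrier M. \<forall>k>0. height M x = enat k \<longrightarrow> |preimages M x| =o \<alpha>s k)"

text \<open>
  The algebras are determined by these properties only up to isomorphism, so a representative is
  chosen.  The type \<^typ>\<open>nat \<times> 'c list\<close> is large enough to contain one for all cardinals on
  \<^typ>\<open>'c\<close>; see the lemmas \<open>is_B_B_alg\<close> and \<open>is_A_A_alg\<close> below.
\<close>

definition B_alg :: "'c rel \<Rightarrow> (nat \<times> 'c list) monounary" where
  "B_alg \<alpha> = (SOME M. is_B \<alpha> M)"

definition A_alg :: "nat \<Rightarrow> (nat \<Rightarrow> 'c rel) \<Rightarrow> (nat \<times> 'c list) monounary" where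
  "A_alg n \<alpha>s = (SOME M. is_A n \<alpha>s M)"

lemma card_of_image_Field:
  assumes "Card_order \<alpha>" "inj_on f (Field \<alpha>)" "S = f ` Field \<alpha>"
  shows "|S| =o \<alpha>"
proof -
  have "bij_betw f (Field \<alpha>) S" using assms by (simp add: bij_betw_def)
  then have "|S| =o |Field \<alpha>|" using card_of_ordIsoI ordIso_symmetric by blast
  then show ?thesis using card_of_Field_ordIso[OF assms(1)] ordIso_transitive by blast
qed

text \<open>
  Existence of \<open>\<B>\<^sub>\<alpha>\<close>: the elements \<open>(k, [])\<close> form an ascending ray, and \<open>(k, w)\<close> is the vertex
  reached from \<open>(k, [])\<close> by descending along \<open>w\<close> (read from the right).  For \<open>k > 0\<close> the child of
  \<open>(k, [])\<close> labelled by the fixed label \<open>e\<close> is replaced by \<open>(k - 1, [])\<close>.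
\<close>

lemma is_B_B_alg:
  fixes \<alpha> :: "'c rel"
  assumes "nonzero_cardinal \<alpha>"
  shows "is_B \<alpha> (B_alg \<alpha>)"
proof -
  from assms have co: "Card_order \<alpha>" and "Field \<alpha> \<noteq> {}" by (auto simp: nonzero_cardinal_def)
  then obtain e where e: "e \<in> Field \<alpha>" by blast
  define up :: "nat \<times> 'c list \<Rightarrow> nat \<times> 'c list"
    where "up = (\<lambda>(k, w). case w of [] \<Rightarrow> (Suc k, []) | x # v \<Rightarrow> (k, v))"
  define M where "M = \<lparr>carrier = {(k, w). set w \<subseteq> Field \<alpha> \<and> (k > 0 \<longrightarrow> w \<noteq> [] \<longrightarrow> last w \<noteq> e)},
                       oper = up\<rparr>"
  have up_simps [simp]: "up (k, []) = (Suc k, [])" "up (k, x # v) = (k, v)" for k x v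
    by (auto simp: up_def)
  have iter_ray: "(up ^^ n) (k, []) = (k + n, [])" for n k
    by (induction n) auto
  have iter_len: "(up ^^ length w) (k, w) = (k, [])" for w k
    by (induction w) (auto simp: funpow_swap1 simp del: funpow.simps simp: funpow_Suc_right)
  have iter: "(up ^^ (n + length w)) (k, w) = (k + n, [])" for n k w
    by (simp add: funpow_add iter_len iter_ray)
  have "monounary_algebra M"
    by (force simp: monounary_algebra_def M_def up_def split: list.splits if_splits)
  moreover have "connected_algebra M"
    unfolding connected_algebra_def M_def
  proof (clarsimp)
    fix k w l v
    have "(up ^^ (l + length w)) (k, w) = (up ^^ (k + length v)) (l, v)"
      by (simp add: iter add.commute)
    then show "\<exists>n m. (up ^^ n) (k, w) = (up ^^ m) (l, v)" by blast
  qed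
  moreover have "(up ^^ n) p \<noteq> p" if "n \<ge> 1" for n p
  proof
    assume eq: "(up ^^ n) p = p"
    obtain k w where p: "p = (k, w)" by force
    define q where "q = (up ^^ length w) p"
    have q: "q = (k, [])" by (simp add: q_def p iter_len)
    have "(up ^^ n) q = q"
      unfolding q_def by (metis eq add.commute comp_apply funpow_add)
    then show False using that by (simp add: q iter_ray)
  qed
  then have "cyclic_elements M = {}" by (auto simp: cyclic_elements_def M_def)
  moreover have "|preimages M p| =o \<alpha>" if "p \<in> carrier M" for p
  proof -
    obtain k w where p: "p = (k, w)" by force
    define f where "f = (\<lambda>x. if w = [] \<and> k > 0 \<and> x = e then (k - 1, []) else (k, x # w))"
    have "preimages M p = f ` Field \<alpha>"
    proof (intro set_eqI iffI)
      fix q assume "q \<in> preimages M p"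
      then obtain l v where q: "q = (l, v)" "(l, v) \<in> carrier M" "up (l, v) = (k, w)"
        by (cases q) (auto simp: preimages_def M_def p)
      show "q \<in> f ` Field \<alpha>"
      proof (cases v)
        case Nil
        then have "q = f e" using q by (auto simp: f_def)
        then show ?thesis using e by blast
      next
        case (Cons x u)
        then have "q = f x" "x \<in> Field \<alpha>" using q by (auto simp: f_def M_def)
        then show ?thesis by blast
      qed
    next
      fix q assume "q \<in> f ` Field \<alpha>"
      then show "q \<in> preimages M p"
        using that by (auto simp: f_def preimages_def M_def p split: if_splits)
    qed
    moreover have "inj_on f (Field \<alpha>)" by (auto simp: inj_on_def f_def)
    ultimately show ?thesis by (intro card_of_image_Field[OF co])
  qed
  ultimately have "is_B \<alpha> M" by (simp add: is_B_def)
  then show ?thesis unfolding B_alg_def by (rule someI)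
qed

text \<open>
  Existence of \<open>\<A>[n; \<alpha>\<^sub>0, \<alpha>\<^sub>1, \<dots>]\<close>: the elements \<open>(i, [])\<close> form the cycle, and \<open>(i, w)\<close> is a
  vertex of height \<open>length w\<close> above \<open>(i, [])\<close>.
\<close>

lemma is_A_A_alg:
  fixes \<alpha>s :: "nat \<Rightarrow> 'c rel"
  assumes "n \<ge> 1" "\<And>k. Card_order (\<alpha>s k)"
  shows "is_A n \<alpha>s (A_alg n \<alpha>s)"
proof -
  define up :: "nat \<times> 'c list \<Rightarrow> nat \<times> 'c list"
    where "up = (\<lambda>(i, w). case w of [] \<Rightarrow> (Suc i mod n, []) | x # v \<Rightarrow> (i, v))"
  define ok where "ok = (\<lambda>w :: 'c list. \<forall>j<length w. rev w ! j \<in> Field (\<alpha>s j))"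
  define M where "M = \<lparr>carrier = {(i, w). i < n \<and> ok w}, oper = up\<rparr>"
  have mem_M: "(i, w) \<in> carrier M \<longleftrightarrow> i < n \<and> ok w" for i w by (simp add: M_def)
  have mem_pre: "(i, w) \<in> preimages M p \<longleftrightarrow> i < n \<and> ok w \<and> up (i, w) = p" for i w p
    by (simp add: M_def preimages_def)
  have up_simps [simp]: "up (i, []) = (Suc i mod n, [])" "up (i, x # v) = (i, v)" for i x v
    by (auto simp: up_def)
  have ok_Nil [simp]: "ok []" by (simp add: ok_def)
  have ok_Cons [simp]: "ok (x # w) \<longleftrightarrow> x \<in> Field (\<alpha>s (length w)) \<and> ok w" for x w
    by (auto simp: ok_def nth_append less_Suc_eq)
  have iter_cycle: "(up ^^ m) (i, []) = ((i + m) mod n, [])" if "i < n" for m i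
    using that by (induction m) (auto simp: mod_Suc_eq)
  have iter_le: "(up ^^ m) (i, w) = (i, drop m w)" if "m \<le> length w" for m i w
    using that
  proof (induction m)
    case (Suc m)
    then have "drop m w = (w ! m) # drop (Suc m) w" by (simp add: Cons_nth_drop_Suc)
    with Suc show ?case by simp
  qed simp
  have iter_gt: "\<exists>j. (up ^^ m) (i, w) = (j, [])" if "m \<ge> length w" for m i w
    using that
  proof (induction m rule: dec_induct)
    case base
    then show ?case by (simp add: iter_le)
  next
    case (step m)
    then show ?case by auto
  qed
  have alg: "monounary_algebra M"
  proof -
    have "(0, []) \<in> carrier M" using assms(1) by (simp add: M_def)
    moreover have "up p \<in> carrier M" if "p \<in> carrier M" for p
      using that assms(1) by (cases p; cases "snd p") (auto simp: M_def)
    moreover have "oper M = up" by (simp add: M_def)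
    ultimately show ?thesis unfolding monounary_algebra_def by blast
  qed
  have "connected_algebra M"
    unfolding connected_algebra_def M_def
  proof (clarsimp)
    fix i w j v assume ij: "i < n" "j < n"
    have to0: "(up ^^ (n - i + length w)) (i, w) = (0, [])" if "i < n" for i w
    proof -
      have "(up ^^ (n - i + length w)) (i, w) = (up ^^ (n - i)) ((up ^^ length w) (i, w))"
        by (simp only: funpow_add comp_apply)
      then show ?thesis using that by (simp add: iter_le iter_cycle)
    qed
    show "\<exists>a b. (up ^^ a) (i, w) = (up ^^ b) (j, v)"
      using to0[OF ij(1), of w] to0[OF ij(2), of v] by metis
  qed
  moreover have cyc: "cyclic_elements M = (\<lambda>i. (i, [])) ` {..<n}"
  proof (intro set_eqI iffI)
    fix p assume "p \<in> cyclic_elements M"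
    then obtain m i w where p: "p = (i, w)" "i < n" "m \<ge> 1" "(up ^^ m) (i, w) = (i, w)"
      by (cases p) (auto simp: cyclic_elements_def M_def)
    have "w = []"
    proof (cases "m \<le> length w")
      case True
      then have "drop m w = w" using p by (simp add: iter_le)
      then have "length w - m = length w" by (metis length_drop)
      then show ?thesis using p(3) by (cases w) auto
    next
      case False
      then show ?thesis using iter_gt[of w m i] p by auto
    qed
    then show "p \<in> (\<lambda>i. (i, [])) ` {..<n}" using p by auto
  next
    fix p assume "p \<in> (\<lambda>i. (i, [] :: 'c list)) ` {..<n}"
    then show "p \<in> cyclic_elements M"
      using assms(1) by (auto simp: cyclic_elements_def M_def iter_cycle intro!: exI[of _ n])
  qed
  then have "finite (cyclic_elements M)" "card (cyclic_elements M) = n"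
    by (auto simp: card_image inj_on_def)
  moreover have pre: "|preimages M (i, w) - cyclic_elements M| =o \<alpha>s (length w)"
    if "(i, w) \<in> carrier M" for i w
  proof (rule card_of_image_Field[OF assms(2)])
    show "preimages M (i, w) - cyclic_elements M = (\<lambda>x. (i, x # w)) ` Field (\<alpha>s (length w))"
    proof (intro set_eqI iffI)
      fix q assume q: "q \<in> preimages M (i, w) - cyclic_elements M"
      then show "q \<in> (\<lambda>x. (i, x # w)) ` Field (\<alpha>s (length w))"
        by (cases q; cases "snd q") (auto simp: mem_pre mem_M cyc)
    next
      fix q assume "q \<in> (\<lambda>x. (i, x # w)) ` Field (\<alpha>s (length w))"
      then show "q \<in> preimages M (i, w) - cyclic_elements M"
        using that by (auto simp: mem_pre mem_M cyc)
    qed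
  qed (auto simp: inj_on_def)
  have "|preimages M c - cyclic_elements M| =o \<alpha>s 0" if "c \<in> cyclic_elements M" for c
  proof -
    obtain i where "c = (i, [])" "i < n" using \<open>c \<in> cyclic_elements M\<close> cyc by auto
    then show ?thesis using pre[of i "[]"] by (simp add: mem_M)
  qed
  moreover have "|preimages M p| =o \<alpha>s k"
    if p: "p \<in> carrier M" and k: "k > 0" and ht: "height M p = enat k" for p k
  proof -
    obtain i w where iw: "p = (i, w)" by force
    have i: "i < n" using p by (simp add: iw M_def)
    have at_len: "(up ^^ length w) (i, w) \<in> cyclic_elements M"
      using i by (simp add: iter_le cyc)
    have before: "(up ^^ m) (i, w) \<notin> cyclic_elements M" if "m < length w" for m
      using that by (auto simp: iter_le cyc)
    have "(LEAST m. (up ^^ m) (i, w) \<in> cyclic_elements M) = length w"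
      using at_len before by (intro Least_equality) (auto simp: not_less[symmetric])
    then have len: "k = length w"
      using ht at_len by (auto simp: height_def iw M_def split: if_splits)
    then have "preimages M p \<inter> cyclic_elements M = {}"
      using k by (auto simp: mem_pre cyc iw)
    then have "preimages M p - cyclic_elements M = preimages M p" by blast
    then show ?thesis using pre[of i w] p iw len by simp
  qed
  ultimately have "is_A n \<alpha>s M" using alg by (simp add: is_A_def)
  then show ?thesis unfolding A_alg_def by (rule someI)
qed

end

(*
  The isomorphism type of a one-generated subalgebra is the kernel {(i, j). theta^i x = theta^j x} of
  its generator x.  The algebra is ultrahomogeneous iff elements x with equal kernels have equally many
  noncyclic preimages: an automorphism moving x to y matches these preimages, and conversely the
  kernel of x determines the kernel of each noncyclic preimage of x, so that a given isomorphism
  between finitely generated subalgebras can be continued backwards along theta, preimage by preimage.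
  Only finitely many preimages of x, and only finitely many components, are already occupied, so
  what remains on both sides is still equinumerous.  The same extension argument, started from one
  element per component, shows that an algebra with this property is determined by its numbers of
  preimages and of components for each kernel, and the sums in the theorem realise all such data.
*)

theory Submission
  imports Defs
begin

section \<open>Orbits and their kernels\<close>

text \<open>Noncyclic preimages are counted, rather than all of them, because cycles leave no
  choice: a subuniverse that every element reaches contains all cyclic elements. The obstacle is
  that infinite cardinals cannot be subtracted, so what is already occupied must be finite near each
  x. Yet new components are entered at one point each, possibly at infinitely many points
  altogether. This is harmless, since the orbits of pairwise unlinked points meet the noncyclic
  preimages of any x in at most one point.

  The kernel of an entry point must depend on its component only; otherwise components could not be
  counted by kernels. The coincidences of iterates that hold eventually form such an invariant, and
  it is attained as a kernel: on the cycle if there is one, at every point otherwise.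

  Extending maps between two algebras M and N, not only inside one, lets a single theorem serve both
  the homogeneity proof (M = N, S finitely generated) and the classification (S empty).\<close>

definition kernel :: "'a monounary \<Rightarrow> 'a \<Rightarrow> (nat \<times> nat) set" where
  "kernel M x = {(i, j). (oper M ^^ i) x = (oper M ^^ j) x}"

definition linked :: "'a monounary \<Rightarrow> 'a \<Rightarrow> 'a \<Rightarrow> bool" where
  "linked M x y \<longleftrightarrow> (\<exists>n m. (oper M ^^ n) x = (oper M ^^ m) y)"

definition separated :: "'a monounary \<Rightarrow> 'a set \<Rightarrow> bool" where
  "separated M B \<longleftrightarrow> (\<forall>b\<in>B. \<forall>b'\<in>B. linked M b b' \<longrightarrow> b = b')"

definition orbits :: "'a monounary \<Rightarrow> 'a set \<Rightarrow> 'a set" where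
  "orbits M X = {(oper M ^^ n) x | n x. x \<in> X}"

text \<open>Discarding cyclic elements gives one notion for both clauses of \<open>is_A\<close>: it
  makes a difference only at cyclic x, since every preimage of a noncyclic element is
  noncyclic.\<close>

definition branch :: "'a monounary \<Rightarrow> 'a \<Rightarrow> 'a set" where
  "branch M x = preimages M x - cyclic_elements M"

text \<open>The algebras are compared only where their kernels coincide; the same kernels need not
  occur in both. \<open>alike M M\<close> is the branching condition equivalent to
  ultrahomogeneity.\<close>

definition alike :: "'a monounary \<Rightarrow> 'b monounary \<Rightarrow> bool" where
  "alike M N \<longleftrightarrow> (\<forall>x\<in>carrier M. \<forall>y\<in>carrier N. kernel M x = kernel N y \<longrightarrow> |branch M x| =o |branch N y| )"

text \<open>Unlike a subalgebra, a subuniverse may be empty.\<close>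

definition subuniverse :: "'a monounary \<Rightarrow> 'a set \<Rightarrow> bool" where
  "subuniverse M S \<longleftrightarrow> S \<subseteq> carrier M \<and> oper M ` S \<subseteq> S"

abbreviation iso_on :: "'a monounary \<Rightarrow> 'a set \<Rightarrow> 'b monounary \<Rightarrow> 'b set \<Rightarrow> ('a \<Rightarrow> 'b) \<Rightarrow> bool" where
  "iso_on M S N T f \<equiv> isomorphism (restrict_algebra M S) (restrict_algebra N T) f"

lemma iso_on_iff:
  "iso_on M S N T f \<longleftrightarrow> bij_betw f S T \<and> (\<forall>x\<in>S. f (oper M x) = oper N (f x))"
  by (simp add: isomorphism_def)

lemma funpow_closed:
  assumes "f ` S \<subseteq> S" "x \<in> S"
  shows "(f ^^ n) x \<in> S"
  using assms by (induction n) auto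

lemma funpow_hom:
  assumes "p ` S \<subseteq> S" "\<And>x. x \<in> S \<Longrightarrow> f (p x) = q (f x)" "x \<in> S"
  shows "f ((p ^^ n) x) = (q ^^ n) (f x)"
  using assms by (induction n) (auto simp: funpow_closed)

lemma funpow_mono_eq:
  fixes f :: "'a \<Rightarrow> 'a"
  assumes "(f ^^ i) x = (f ^^ j) y"
  shows "(f ^^ (n + i)) x = (f ^^ (n + j)) y"
  by (simp only: funpow_add comp_apply assms)

lemma kernel_hom:
  assumes "oper M ` S \<subseteq> S" "\<And>x. x \<in> S \<Longrightarrow> f (oper M x) = oper N (f x)" "inj_on f S" "x \<in> S"
  shows "kernel N (f x) = kernel M x"
proof -
  have "(oper N ^^ i) (f x) = (oper N ^^ j) (f x) \<longleftrightarrow> (oper M ^^ i) x = (oper M ^^ j) x" for i j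
    using funpow_hom[of "oper M" S f "oper N" x] funpow_closed[of "oper M" S x] assms
    by (metis inj_onD)
  then show ?thesis by (auto simp: kernel_def)
qed

lemma mem_cyclic_iff_kernel:
  "x \<in> cyclic_elements M \<longleftrightarrow> x \<in> carrier M \<and> (\<exists>n\<ge>1. (n, 0) \<in> kernel M x)"
  by (auto simp: cyclic_elements_def kernel_def)

lemma branch_iff:
  "z \<in> branch M x \<longleftrightarrow> z \<in> carrier M \<and> oper M z = x \<and> z \<notin> cyclic_elements M"
  by (auto simp: branch_def preimages_def)

text \<open>A noncyclic z is never revisited by its own orbit, so apart from \<open>(0, 0)\<close>
  only the coincidences of x, delayed by one step, remain.\<close>

lemma kernel_branch:
  assumes "z \<in> branch M x"
  shows "kernel M z = insert (0, 0) {(Suc i, Suc j) | i j. (i, j) \<in> kernel M x}"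
proof -
  have z: "oper M z = x" "z \<in> carrier M" "z \<notin> cyclic_elements M" using assms by (auto simp: branch_iff)
  have no: "(oper M ^^ Suc n) z \<noteq> z" for n
    using z(2,3) by (auto simp: cyclic_elements_def simp del: funpow.simps)
  have sh: "(oper M ^^ Suc n) z = (oper M ^^ n) x" for n
    using z(1) by (simp only: funpow_Suc_right comp_apply)
  have "(i, j) \<in> kernel M z \<longleftrightarrow>
      (i = 0 \<and> j = 0 \<or> (\<exists>i' j'. i = Suc i' \<and> j = Suc j' \<and> (i', j') \<in> kernel M x))" for i j
    using no[of "i - 1"] no[of "j - 1"] no[of "j - 1", symmetric]
    by (cases i; cases j) (simp_all add: kernel_def sh del: funpow.simps(2))
  then show ?thesis by auto
qed

lemma kernel_iterate:
  "(i, j) \<in> kernel M ((oper M ^^ n) x) \<longleftrightarrow> (i + n, j + n) \<in> kernel M x"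
  by (simp add: kernel_def funpow_add)

section \<open>Connected components and generated subuniverses\<close>

lemma linked_refl: "linked M x x"
  by (auto simp: linked_def)

lemma linked_sym: "linked M x y \<Longrightarrow> linked M y x"
  unfolding linked_def by metis

lemma linked_trans:
  assumes "linked M x y" "linked M y z"
  shows "linked M x z"
proof -
  obtain a b c d where "(oper M ^^ a) x = (oper M ^^ b) y" "(oper M ^^ c) y = (oper M ^^ d) z"
    using assms by (auto simp: linked_def)
  then have "(oper M ^^ (c + a)) x = (oper M ^^ (b + d)) z"
    by (metis add.commute funpow_mono_eq)
  then show ?thesis unfolding linked_def by blast
qed

lemma linked_iterate: "linked M x ((oper M ^^ n) x)"
  unfolding linked_def by (metis funpow_0)

lemma subuniverse_orbits:
  assumes "monounary_algebra M" "X \<subseteq> carrier M"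
  shows "subuniverse M (orbits M X)"
proof -
  have "(oper M ^^ n) x \<in> carrier M" if "x \<in> X" for n x
    using that assms by (auto simp: monounary_algebra_def intro: funpow_closed)
  moreover have "oper M ((oper M ^^ n) x) \<in> orbits M X" if "x \<in> X" for n x
    using that unfolding orbits_def by (metis (mono_tags, lifting) CollectI comp_apply funpow.simps(2))
  ultimately show ?thesis by (auto simp: subuniverse_def orbits_def)
qed

lemma orbits_superset: "X \<subseteq> orbits M X"
  unfolding orbits_def by clarsimp (metis funpow_0)

lemma hull_eq_orbits:
  assumes "monounary_algebra M" "X \<subseteq> carrier M" "X \<noteq> {}"
  shows "subalgebra M hull X = orbits M X"
proof (rule hull_unique)
  show "X \<subseteq> orbits M X" by (rule orbits_superset)
  then show "subalgebra M (orbits M X)"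
    using subuniverse_orbits[OF assms(1,2)] assms(3) by (auto simp: subalgebra_def subuniverse_def)
next
  fix S assume "X \<subseteq> S" "subalgebra M S"
  then show "orbits M X \<subseteq> S" by (auto simp: orbits_def subalgebra_def intro: funpow_closed)
qed

text \<open>The common image x links the generators of z and z', so both points lie in one orbit.
  Within an orbit, the later of two different iterates with the same image is cyclic, and a branch
  has no cyclic members.\<close>

lemma branch_orbits_unique:
  assumes "monounary_algebra M" "B \<subseteq> carrier M" "separated M B"
    and "z \<in> branch M x \<inter> orbits M B" "z' \<in> branch M x \<inter> orbits M B"
  shows "z = z'"
proof -
  have eq: "oper M ((oper M ^^ i) b) = oper M ((oper M ^^ j) b) \<Longrightarrow> (oper M ^^ j) b \<in> carrier M \<Longrightarrow>
    i < j \<Longrightarrow> (oper M ^^ j) b \<in> cyclic_elements M" for i j b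
  proof -
    assume *: "oper M ((oper M ^^ i) b) = oper M ((oper M ^^ j) b)" "(oper M ^^ j) b \<in> carrier M" "i < j"
    \<comment> \<open>After \<open>j - Suc i\<close> further steps the left iterate sits exactly at
      position j; this exhibits the period \<open>j - i\<close>.\<close>
    then have "(oper M ^^ (j - Suc i + Suc j)) b = (oper M ^^ (j - Suc i + Suc i)) b"
      by (intro funpow_mono_eq) auto
    moreover have "(j - Suc i + Suc i) = j" "j - Suc i + Suc j = (j - i) + j" using *(3) by auto
    ultimately have "(oper M ^^ (j - i)) ((oper M ^^ j) b) = (oper M ^^ j) b"
      by (metis comp_apply funpow_add)
    then show ?thesis using * by (auto simp: cyclic_elements_def intro!: exI[of _ "j - i"])
  qed
  obtain i b j b' where z: "b \<in> B" "z = (oper M ^^ i) b" "b' \<in> B" "z' = (oper M ^^ j) b'"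
    using assms(4,5) by (auto simp: orbits_def)
  have op: "oper M z = x" "oper M z' = x" "z \<in> carrier M" "z' \<in> carrier M"
    "z \<notin> cyclic_elements M" "z' \<notin> cyclic_elements M"
    using assms(4,5) by (auto simp: branch_iff)
  then have "(oper M ^^ Suc i) b = (oper M ^^ Suc j) b'" using z by simp
  then have "b = b'" using z assms(3) unfolding separated_def linked_def by blast
  then have "i = j" using eq[of i b j] eq[of j b i] z op by (metis linorder_neqE_nat)
  then show ?thesis using z \<open>b = b'\<close> by simp
qed

text \<open>\<open>B\<close> may be infinite: it will be the set of entry points of all components
  not yet touched.\<close>

lemma finite_branch_orbits:
  assumes "monounary_algebra M" "B \<subseteq> carrier M" "separated M B"
  shows "finite (branch M x \<inter> orbits M B)"
proof (cases "branch M x \<inter> orbits M B = {}")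
  case False
  then obtain z where "z \<in> branch M x \<inter> orbits M B" by blast
  then have "branch M x \<inter> orbits M B \<subseteq> {z}" using branch_orbits_unique[OF assms] by blast
  then show ?thesis by (rule finite_subset) simp
qed (simp only: finite.emptyI)

text \<open>Finitely many generators need not be separated, so they are treated one at a time; a
  singleton is separated.\<close>

lemma finite_branch_orbits_finite:
  assumes "monounary_algebra M" "X \<subseteq> carrier M" "finite X"
  shows "finite (branch M x \<inter> orbits M X)"
proof -
  have eq: "branch M x \<inter> orbits M X = (\<Union>b\<in>X. branch M x \<inter> orbits M {b})"
    by (auto simp: orbits_def)
  have "finite (branch M x \<inter> orbits M {b})" if "b \<in> X" for b
    using that assms by (intro finite_branch_orbits) (auto simp: separated_def)
  then show ?thesis unfolding eq by (rule finite_UN_I[OF assms(3)])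
qed

section \<open>Extending isomorphisms\<close>

lemma infinite_ordIso_Diff_finite:
  assumes "infinite X" "finite A"
  shows "|X| =o |X - A|"
  using assms(2)
proof (induction A rule: finite_induct)
  case empty
  then show ?case by (simp add: card_of_refl)
next
  case (insert a A)
  have "\<exists>h. bij_betw h (X - A) (X - A - {a})"
    using assms(1) insert(1) by (intro infinite_imp_bij_betw) simp
  moreover have "X - A - {a} = X - insert a A" by blast
  ultimately have "|X - A| =o |X - insert a A|" by (simp add: card_of_ordIso[symmetric])
  then show ?case using insert.IH ordIso_transitive by blast
qed

text \<open>For finite \<open>X\<close> this is subtraction of numbers; for infinite
  \<open>X\<close> removing finitely many points does not change the cardinality. It would fail for
  infinite \<open>A\<close>.\<close>

lemma ordIso_Diff_finite:
  assumes "|X| =o |Y|" "A \<subseteq> X" "A' \<subseteq> Y" "finite A" "bij_betw \<phi> A A'"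
  shows "|X - A| =o |Y - A'|"
proof (cases "finite X")
  case True
  have fY: "finite Y" and fA': "finite A'" using True assms card_of_ordIso_finite bij_betw_finite by blast+
  have "card X = card Y" "card A = card A'"
    using assms(1,5) True fY by (auto simp: card_of_ordIso[symmetric] bij_betw_same_card)
  then have "card (X - A) = card (Y - A')" using assms fA' by (simp add: card_Diff_subset)
  then show ?thesis using True fY
    by (meson bij_betw_iff_card card_of_ordIso finite_Diff)
next
  case False
  then have iY: "infinite Y" using assms(1) card_of_ordIso_finite by blast
  have fA': "finite A'" using assms(4,5) bij_betw_finite by blast
  show ?thesis
    using ordIso_transitive[OF ordIso_symmetric[OF infinite_ordIso_Diff_finite[OF False assms(4)]]
        ordIso_transitive[OF assms(1) infinite_ordIso_Diff_finite[OF iY fA']]] .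
qed

text \<open>Induction on the number of steps into \<open>S\<close>. The step passes from
  \<open>oper M x\<close> back to x outside \<open>S\<close>, which is the shape of a map defined
  preimage by preimage.\<close>

lemma reach_induct [consumes 3, case_names base step]:
  assumes "monounary_algebra M" "x \<in> carrier M" "(oper M ^^ n) x \<in> S"
    and base: "\<And>x. x \<in> S \<Longrightarrow> P x"
    and step: "\<And>x. x \<in> carrier M \<Longrightarrow> x \<notin> S \<Longrightarrow> P (oper M x) \<Longrightarrow> P x"
  shows "P x"
  using assms(2,3)
proof (induction n arbitrary: x)
  case 0
  then show ?case using base by simp
next
  case (Suc n)
  have "oper M x \<in> carrier M" using assms(1) Suc.prems by (auto simp: monounary_algebra_def)
  moreover have "(oper M ^^ n) (oper M x) \<in> S" using Suc.prems(2) by (simp add: funpow_swap1)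
  ultimately have "P (oper M x)" by (rule Suc.IH)
  then show ?case using base step Suc.prems by blast
qed

text \<open>A cyclic element that enters \<open>S\<close> stays in \<open>S\<close> while it
  completes its round and returns to its start.\<close>

lemma cyclic_subset_subuniverse:
  assumes "subuniverse M S" "\<And>x. x \<in> carrier M \<Longrightarrow> \<exists>n. (oper M ^^ n) x \<in> S"
  shows "cyclic_elements M \<subseteq> S"
proof
  fix x assume x: "x \<in> cyclic_elements M"
  then obtain m n where m: "m \<ge> 1" "(oper M ^^ m) x = x" and n: "(oper M ^^ n) x \<in> S"
    using assms(2)[of x] by (auto simp: cyclic_elements_def)
  \<comment> \<open>\<open>m * n\<close> is a multiple of the period that is at least n.\<close>
  have "(oper M ^^ (m * n)) x = x" using m(2) by (metis funpow_mod_eq funpow_0 mod_mult_self1_is_0)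
  moreover have "m * n = (m * n - n) + n" using m(1) by simp
  ultimately have "x = (oper M ^^ (m * n - n)) ((oper M ^^ n) x)" by (metis comp_apply funpow_add)
  then show "x \<in> S" using n assms(1) by (metis funpow_closed subuniverse_def)
qed

text \<open>The map grows outwards from \<open>S\<close>: when x has gone to y, the unoccupied
  preimages of x are matched with those of y. Finiteness of the occupied part keeps these sets
  equinumerous, and equality of kernels is handed on to the new pairs, so the process never gets
  stuck.\<close>

lemma extend_along_preimages:
  assumes algM: "monounary_algebra M" and algN: "monounary_algebra N"
    and S: "subuniverse M S" and T: "subuniverse N T" and f: "iso_on M S N T f"
    and reachS: "\<And>x. x \<in> carrier M \<Longrightarrow> \<exists>n. (oper M ^^ n) x \<in> S"
    and reachT: "\<And>y. y \<in> carrier N \<Longrightarrow> \<exists>n. (oper N ^^ n) y \<in> T"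
    and alike: "alike M N" and fin: "\<And>x. finite (branch M x \<inter> S)"
  obtains g where "isomorphism M N g" "\<And>x. x \<in> S \<Longrightarrow> g x = f x"
proof -
  let ?p = "oper M" and ?q = "oper N"
  have cM: "x \<in> carrier M \<Longrightarrow> ?p x \<in> carrier M" and cN: "y \<in> carrier N \<Longrightarrow> ?q y \<in> carrier N" for x y
    using algM algN by (auto simp: monounary_algebra_def)
  have Sc: "x \<in> S \<Longrightarrow> x \<in> carrier M" "x \<in> S \<Longrightarrow> ?p x \<in> S" for x using S by (auto simp: subuniverse_def)
  have Tc: "y \<in> T \<Longrightarrow> y \<in> carrier N" "y \<in> T \<Longrightarrow> ?q y \<in> T" for y using T by (auto simp: subuniverse_def)
  have cycS: "cyclic_elements M \<subseteq> S" and cycT: "cyclic_elements N \<subseteq> T"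
    using cyclic_subset_subuniverse S T reachS reachT by blast+
  have fbij: "bij_betw f S T" and fhom: "\<And>x. x \<in> S \<Longrightarrow> f (?p x) = ?q (f x)"
    using f by (auto simp: iso_on_iff)
  have finj: "inj_on f S" and fim: "f ` S = T" using fbij by (auto simp: bij_betw_def)
  have fker: "kernel N (f x) = kernel M x" if "x \<in> S" for x
    using kernel_hom[of M S f N x] S finj fhom that by (auto simp: subuniverse_def)
  have fcyc: "f x \<in> cyclic_elements N \<longleftrightarrow> x \<in> cyclic_elements M" if "x \<in> S" for x
    using that fker[OF that] fim Sc(1) Tc(1) by (auto simp: mem_cyclic_iff_kernel)
  \<comment> \<open>The invariant of a pair x, y with y the value at x. Its last clause lets
    \<open>f\<close> match the occupied preimages of x with those of y.\<close>
  define R where "R x y \<longleftrightarrow> x \<in> carrier M \<and> y \<in> carrier N \<and> kernel M x = kernel N y \<and>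
    (x \<in> S \<or> y \<in> T \<longrightarrow> x \<in> S \<and> y = f x)" for x y
  \<comment> \<open>All cycles are occupied, so the unoccupied preimages are noncyclic.\<close>
  have diffM: "preimages M x - S = branch M x - (branch M x \<inter> S)" for x
    using cycS by (auto simp: branch_def)
  have diffN: "preimages N y - T = branch N y - (branch N y \<inter> T)" for y
    using cycT by (auto simp: branch_def)
  have "\<exists>h. bij_betw h (preimages M x - S) (preimages N y - T)" if R: "R x y" for x y
  proof -
    have "bij_betw f (branch M x \<inter> S) (branch N y \<inter> T)"
    proof (cases "x \<in> S")
      case True
      then have y: "y = f x" using R by (simp add: R_def)
      have "f ` (branch M x \<inter> S) = branch N y \<inter> T"
      proof (intro set_eqI iffI)
        fix w assume "w \<in> f ` (branch M x \<inter> S)"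
        then obtain z where "w = f z" "z \<in> S" "?p z = x" "z \<notin> cyclic_elements M" by (auto simp: branch_iff)
        then show "w \<in> branch N y \<inter> T" using y fhom[of z] fcyc[of z] fim Tc(1) by (auto simp: branch_iff)
      next
        fix w assume w: "w \<in> branch N y \<inter> T"
        then obtain z where z: "w = f z" "z \<in> S" using fim by blast
        then have "f (?p z) = f x" using w y fhom[of z] by (auto simp: branch_iff)
        then have "?p z = x" using finj True z Sc by (meson inj_onD)
        then have "z \<in> branch M x" using w z Sc(1) fcyc[of z] by (auto simp: branch_iff)
        then show "w \<in> f ` (branch M x \<inter> S)" using z by blast
      qed
      then show ?thesis using finj by (auto simp: bij_betw_def inj_on_subset)
    next
      case False
      \<comment> \<open>An occupied preimage would put x into \<open>S\<close> or y into
        \<open>T\<close>, as these are closed; the invariant excludes both.\<close>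
      then have "branch M x \<inter> S = {}" "branch N y \<inter> T = {}"
        using R Sc(2) Tc(2) by (auto simp: R_def branch_iff)
      then show ?thesis by (simp add: bij_betw_def)
    qed
    moreover have "|branch M x| =o |branch N y|" using R alike by (auto simp: R_def alike_def)
    ultimately show ?thesis unfolding diffM diffN card_of_ordIso
      using fin by (intro ordIso_Diff_finite) auto
  qed
  \<comment> \<open>The bijection is chosen once for each pair x, y, so all preimages of x use the
    same one.\<close>
  then obtain h where h: "\<And>x y. R x y \<Longrightarrow> bij_betw (h x y) (preimages M x - S) (preimages N y - T)"
    by metis
  have hpre: "h x y z \<in> preimages N y - T" if "R x y" "z \<in> preimages M x - S" for x y z
    using h[OF that(1)] that(2) bij_betwE by metis
  have step: "R z (h x y z)" if R: "R x y" and z: "z \<in> preimages M x - S" for x y z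
  proof -
    have w: "h x y z \<in> preimages N y - T" using hpre R z by blast
    have "z \<in> branch M x" "h x y z \<in> branch N y" using z w cycS cycT by (auto simp: branch_def)
    then have "kernel M z = kernel N (h x y z)" 
      using R kernel_branch[of z M x] kernel_branch[of "h x y z" N y] by (simp add: R_def)
    then show ?thesis using z w by (auto simp: R_def preimages_def)
  qed
  \<comment> \<open>Recursion on the distance \<open>d\<close> to \<open>S\<close>: only the values
    of \<open>G k\<close> at points of distance k enter \<open>g\<close>.\<close>
  define G where "G = rec_nat f (\<lambda>_ g x. if x \<in> S then f x else h (?p x) (g (?p x)) x)"
  define d where "d x = (LEAST n. (?p ^^ n) x \<in> S)" for x
  define g where "g x = G (d x) x" for x
  have gS: "g x = f x" if "x \<in> S" for x
    using that by (cases "d x") (auto simp: g_def G_def)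
  have gstep: "g x = h (?p x) (g (?p x)) x" if "x \<in> carrier M" "x \<notin> S" for x
  proof -
    obtain n where "(?p ^^ n) x \<in> S" using reachS \<open>x \<in> carrier M\<close> by blast
    then have "d x = Suc (LEAST m. (?p ^^ Suc m) x \<in> S)"
      unfolding d_def using \<open>x \<notin> S\<close> by (intro Least_Suc) auto
    then have "d x = Suc (d (?p x))" by (simp add: d_def funpow_swap1)
    then show ?thesis using \<open>x \<notin> S\<close> by (simp add: g_def G_def)
  qed
  have pre: "x \<in> preimages M (?p x) - S" if "x \<in> carrier M" "x \<notin> S" for x
    using that by (simp add: preimages_def)
  have gR: "R x (g x)" if "x \<in> carrier M" for x
  proof -
    obtain n where "(?p ^^ n) x \<in> S" using reachS \<open>x \<in> carrier M\<close> by blast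
    with algM \<open>x \<in> carrier M\<close> show ?thesis
    proof (induction rule: reach_induct)
      case (base x)
      then show ?case using gS fker Sc Tc fim by (auto simp: R_def)
    next
      case (step x)
      then show ?case using \<open>\<And>z y x. \<lbrakk>R x y; z \<in> preimages M x - S\<rbrakk> \<Longrightarrow> R z (h x y z)\<close> gstep pre by metis
    qed
  qed
  have gpre: "g x \<in> preimages N (g (?p x)) - T" if "x \<in> carrier M" "x \<notin> S" for x
    using hpre gR gstep pre that cM by metis
  have ghom: "g (?p x) = ?q (g x)" if "x \<in> carrier M" for x
    using that gS fhom Sc gpre by (cases "x \<in> S") (auto simp: preimages_def)
  have gT: "g x \<in> T \<longleftrightarrow> x \<in> S" if "x \<in> carrier M" for x
    using that gpre gS fim by (cases "x \<in> S") auto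
  \<comment> \<open>The quantifier over y stays inside the induction, so that the hypothesis for
    \<open>?p x\<close> can be applied to \<open>?p y\<close>. Once the images agree, x and y are
    preimages of one point and get their values from one bijection.\<close>
  have inj: "\<forall>y\<in>carrier M. g x = g y \<longrightarrow> x = y" if "x \<in> carrier M" for x
  proof -
    obtain n where "(?p ^^ n) x \<in> S" using reachS \<open>x \<in> carrier M\<close> by blast
    with algM \<open>x \<in> carrier M\<close> show ?thesis
    proof (induction rule: reach_induct)
      case (base x)
      then show ?case using gS gT finj Sc by (metis inj_onD)
    next
      case (step x)
      show ?case
      proof (intro ballI impI)
        fix y assume y: "y \<in> carrier M" "g x = g y"
        then have yS: "y \<notin> S" using gT step by metis
        have "g (?p x) = g (?p y)" using ghom y step by metis
        then have eq: "?p x = ?p y" using step cM y by blast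
        then have "h (?p x) (g (?p x)) x = h (?p x) (g (?p x)) y" using gstep y yS step by metis
        then show "x = y" using h[OF gR[OF cM[OF step(1)]]] pre step y yS eq
          by (metis bij_betw_def inj_onD)
      qed
    qed
  qed
  have surj: "\<exists>x\<in>carrier M. g x = y" if "y \<in> carrier N" for y
  proof -
    obtain n where "(?q ^^ n) y \<in> T" using reachT \<open>y \<in> carrier N\<close> by blast
    with algN \<open>y \<in> carrier N\<close> show ?thesis
    proof (induction rule: reach_induct)
      case (base y)
      then show ?case using fim gS Sc by (metis imageE)
    next
      case (step y)
      then obtain x where x: "x \<in> carrier M" "g x = ?q y" by blast
      have "y \<in> preimages N (g x) - T" using step x by (simp add: preimages_def)
      then obtain z where z: "z \<in> preimages M x - S" "y = h x (g x) z"
        using h[OF gR[OF x(1)]] by (metis bij_betw_def imageE)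
      then have "g z = y" using gstep[of z] by (auto simp: preimages_def)
      then show ?case using z by (auto simp: preimages_def)
    qed
  qed
  have "g ` carrier M = carrier N" using gR surj by (fastforce simp: R_def)
  then have "isomorphism M N g"
    using inj ghom unfolding isomorphism_def bij_betw_def by (auto intro!: inj_onI)
  then show ?thesis using gS that by blast
qed

text \<open>On the orbit of b the n-th iterate of b must go to the n-th iterate of
  \<open>\<sigma> b\<close>. Equality of the two kernels makes this both well defined and injective,
  and unlinkedness prevents collisions with other orbits or with the old domain.\<close>

lemma extend_to_orbits:
  assumes S: "subuniverse M S" and T: "subuniverse N T" and f: "iso_on M S N T f"
    and \<sigma>: "bij_betw \<sigma> B B'" and ker: "\<And>b. b \<in> B \<Longrightarrow> kernel M b = kernel N (\<sigma> b)"
    and sepM: "separated M B" "\<And>b s. b \<in> B \<Longrightarrow> s \<in> S \<Longrightarrow> \<not> linked M b s"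
    and sepN: "separated N B'" "\<And>b s. b \<in> B' \<Longrightarrow> s \<in> T \<Longrightarrow> \<not> linked N b s"
  obtains g where "iso_on M (S \<union> orbits M B) N (T \<union> orbits N B') g" "\<And>x. x \<in> S \<Longrightarrow> g x = f x"
    "\<And>b. b \<in> B \<Longrightarrow> g b = \<sigma> b"
proof -
  let ?p = "oper M" and ?q = "oper N"
  have fbij: "bij_betw f S T" and fhom: "\<And>x. x \<in> S \<Longrightarrow> f (?p x) = ?q (f x)"
    using f by (auto simp: iso_on_iff)
  have S': "x \<in> S \<Longrightarrow> ?p x \<in> S" for x using S by (auto simp: subuniverse_def)
  \<comment> \<open>A point may be an iterate of b for many exponents; one is picked, and the fact
    \<open>g\<close> below shows that the choice does not affect the value.\<close>
  define e where "e z = (SOME (b, n). b \<in> B \<and> (?p ^^ n) b = z)" for z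
  define g where "g z = (if z \<in> S then f z else case e z of (b, n) \<Rightarrow> (?q ^^ n) (\<sigma> b))" for z
  have notS: "(?p ^^ n) b \<notin> S" if "b \<in> B" for b n
    using sepM(2)[OF that] linked_iterate[of M b n] by blast
  have g: "g ((?p ^^ n) b) = (?q ^^ n) (\<sigma> b)" if b: "b \<in> B" for b n
  proof -
    obtain b' m where e: "e ((?p ^^ n) b) = (b', m)" by force
    have "case e ((?p ^^ n) b) of (b', m) \<Rightarrow> b' \<in> B \<and> (?p ^^ m) b' = (?p ^^ n) b"
      unfolding e_def by (rule someI[of _ "(b, n)"]) (use b in auto)
    then have b': "b' \<in> B" "(?p ^^ m) b' = (?p ^^ n) b" by (auto simp: e)
    then have "b' = b" using b sepM(1) unfolding separated_def linked_def by blast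
    then have "(m, n) \<in> kernel N (\<sigma> b)" using b' ker[OF b] by (auto simp: kernel_def)
    then show ?thesis using notS[OF b] e \<open>b' = b\<close> by (simp add: g_def kernel_def)
  qed
  have gS: "g x = f x" if "x \<in> S" for x using that by (simp add: g_def)
  have \<sigma>B: "\<sigma> b \<in> B'" if "b \<in> B" for b using that \<sigma> by (auto simp: bij_betw_def)
  have im: "g ` (S \<union> orbits M B) = T \<union> orbits N B'"
  proof -
    have "g ` S = T" using fbij gS by (auto simp: bij_betw_def)
    moreover have "g ` orbits M B = orbits N B'"
    proof (intro set_eqI iffI)
      fix w assume "w \<in> g ` orbits M B"
      then obtain n b where "b \<in> B" "w = g ((?p ^^ n) b)" by (auto simp: orbits_def)
      then show "w \<in> orbits N B'" using g[of b n] \<sigma>B[of b] unfolding orbits_def by blast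
    next
      fix w assume "w \<in> orbits N B'"
      then obtain n b where "b \<in> B" "w = (?q ^^ n) (\<sigma> b)" using \<sigma> by (auto simp: orbits_def bij_betw_def)
      then have "w = g ((?p ^^ n) b)" "(?p ^^ n) b \<in> orbits M B" using g[of b n] unfolding orbits_def by auto
      then show "w \<in> g ` orbits M B" by blast
    qed
    ultimately show ?thesis by (simp add: image_Un)
  qed
  have sep: False if "s \<in> S" "b \<in> B" "f s = (?q ^^ n) (\<sigma> b)" for s b n
    using sepN(2)[OF \<sigma>B[OF that(2)], of "f s"] that fbij linked_iterate[of N "\<sigma> b" n]
      bij_betwE by metis
  have inj: "inj_on g (S \<union> orbits M B)"
  proof (rule inj_onI)
    fix x y assume xy: "x \<in> S \<union> orbits M B" "y \<in> S \<union> orbits M B" "g x = g y"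
    consider "x \<in> S" "y \<in> S" | n b where "x \<in> S" "b \<in> B" "y = (?p ^^ n) b"
      | n b where "y \<in> S" "b \<in> B" "x = (?p ^^ n) b"
      | n b m c where "b \<in> B" "x = (?p ^^ n) b" "c \<in> B" "y = (?p ^^ m) c"
      using xy(1,2) by (auto simp: orbits_def)
    then show "x = y"
    proof cases
      case 1
      then show ?thesis using xy(3) gS fbij by (auto simp: bij_betw_def dest: inj_onD)
    next
      case 2
      then show ?thesis using xy(3) sep gS g by metis
    next
      case 3
      then show ?thesis using xy(3) sep gS g by metis
    next
      case 4
      then have eq: "(?q ^^ n) (\<sigma> b) = (?q ^^ m) (\<sigma> c)" using xy(3) g by metis
      then have "linked N (\<sigma> b) (\<sigma> c)" by (auto simp: linked_def)
      then have "\<sigma> b = \<sigma> c" using sepN(1) \<sigma>B 4 by (auto simp: separated_def)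
      then have "b = c" using \<sigma> 4 by (auto simp: bij_betw_def dest: inj_onD)
      moreover have "(n, m) \<in> kernel M b" using ker[of b] eq \<open>b = c\<close> 4 by (simp add: kernel_def)
      ultimately show ?thesis using 4 by (simp add: kernel_def)
    qed
  qed
  have "g (?p x) = ?q (g x)" if "x \<in> S \<union> orbits M B" for x
    using that
  proof
    assume "x \<in> S"
    then show ?thesis using gS fhom S' by simp
  next
    assume "x \<in> orbits M B"
    then obtain n b where b: "b \<in> B" "x = (?p ^^ n) b" by (auto simp: orbits_def)
    then show ?thesis using g[of b n] g[of b "Suc n"] by simp
  qed
  then have "iso_on M (S \<union> orbits M B) N (T \<union> orbits N B') g"
    using inj im by (auto simp: iso_on_iff bij_betw_def)
  then show ?thesis using that gS g[of _ 0] by simp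
qed

text \<open>The orbits of \<open>B\<close> open the components that miss \<open>S\<close>; then
  every element reaches the enlarged domain and the preimages can be filled in. Branches stay
  finitely occupied since a separated \<open>B\<close> adds at most one point to each.\<close>

lemma extend_isomorphism:
  assumes "monounary_algebra M" "monounary_algebra N" "alike M N"
    and S: "subuniverse M S" and T: "subuniverse N T" and f: "iso_on M S N T f"
    and fin: "\<And>x. finite (branch M x \<inter> S)"
    and B: "B \<subseteq> carrier M" "B' \<subseteq> carrier N"
    and \<sigma>: "bij_betw \<sigma> B B'" and ker: "\<And>b. b \<in> B \<Longrightarrow> kernel M b = kernel N (\<sigma> b)"
    and sepM: "separated M B" "\<And>b s. b \<in> B \<Longrightarrow> s \<in> S \<Longrightarrow> \<not> linked M b s"
    and sepN: "separated N B'" "\<And>b s. b \<in> B' \<Longrightarrow> s \<in> T \<Longrightarrow> \<not> linked N b s"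
    and coverM: "\<And>x. x \<in> carrier M \<Longrightarrow> \<exists>b\<in>S \<union> B. linked M x b"
    and coverN: "\<And>y. y \<in> carrier N \<Longrightarrow> \<exists>b\<in>T \<union> B'. linked N y b"
  obtains g where "isomorphism M N g" "\<And>x. x \<in> S \<Longrightarrow> g x = f x"
proof -
  obtain g where g: "iso_on M (S \<union> orbits M B) N (T \<union> orbits N B') g" "\<And>x. x \<in> S \<Longrightarrow> g x = f x"
    by (rule extend_to_orbits[OF S T f \<sigma> ker sepM sepN]) blast+
  have SB: "subuniverse M (S \<union> orbits M B)" and TB: "subuniverse N (T \<union> orbits N B')"
    using S T subuniverse_orbits assms(1,2) B by (auto simp: subuniverse_def image_subset_iff)
  have "\<exists>n. (oper M ^^ n) x \<in> S \<union> orbits M B" if x: "x \<in> carrier M" for x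
  proof -
    obtain b n m where "b \<in> S \<union> B" "(oper M ^^ n) x = (oper M ^^ m) b"
      using coverM[OF x] unfolding linked_def by blast
    moreover from this(1) have "(oper M ^^ m) b \<in> S \<union> orbits M B"
      using SB orbits_superset[of B M] by (intro funpow_closed) (auto simp: subuniverse_def)
    ultimately show ?thesis by metis
  qed
  moreover have "\<exists>n. (oper N ^^ n) y \<in> T \<union> orbits N B'" if y: "y \<in> carrier N" for y
  proof -
    obtain b n m where "b \<in> T \<union> B'" "(oper N ^^ n) y = (oper N ^^ m) b"
      using coverN[OF y] unfolding linked_def by blast
    moreover from this(1) have "(oper N ^^ m) b \<in> T \<union> orbits N B'"
      using TB orbits_superset[of B' N] by (intro funpow_closed) (auto simp: subuniverse_def)
    ultimately show ?thesis by metis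
  qed
  moreover have "finite (branch M x \<inter> (S \<union> orbits M B))" for x
    using fin finite_branch_orbits[OF assms(1) B(1) sepM(1)] by (simp add: Int_Un_distrib)
  ultimately obtain k where "isomorphism M N k" "\<And>x. x \<in> S \<union> orbits M B \<Longrightarrow> k x = g x"
    using extend_along_preimages[OF assms(1,2) SB TB g(1) _ _ assms(3)] by blast
  then show ?thesis using g(2) that by auto
qed

section \<open>Transversals of the connected components\<close>

text \<open>Unlike the kernel, this is constant on components: it is congruence modulo n if the
  component has a cycle of length n, and \<open>Id\<close> if it has none.\<close>

definition eventual_kernel :: "'a monounary \<Rightarrow> 'a \<Rightarrow> (nat \<times> nat) set" where
  "eventual_kernel M x = {(i, j). \<exists>n. (oper M ^^ (n + i)) x = (oper M ^^ (n + j)) x}"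

text \<open>The kernel condition puts the representative on the cycle, if its component has one.\<close>

definition root :: "'a monounary \<Rightarrow> 'a \<Rightarrow> 'a" where
  "root M x = (SOME y. y \<in> carrier M \<and> linked M x y \<and> kernel M y = eventual_kernel M x)"

lemma eventual_kernel_iterate:
  "eventual_kernel M ((oper M ^^ n) x) = eventual_kernel M x"
proof -
  have "(\<exists>k. (oper M ^^ (k + i)) ((oper M ^^ n) x) = (oper M ^^ (k + j)) ((oper M ^^ n) x)) \<longleftrightarrow>
    (\<exists>k. (oper M ^^ (k + i)) x = (oper M ^^ (k + j)) x)" (is "?L \<longleftrightarrow> ?R") for i j
  proof
    assume ?L
    then obtain k where "(oper M ^^ (k + i + n)) x = (oper M ^^ (k + j + n)) x"
      by (auto simp only: funpow_add comp_apply)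
    then have "(oper M ^^ ((k + n) + i)) x = (oper M ^^ ((k + n) + j)) x"
      by (simp only: ac_simps)
    then show ?R by blast
  next
    assume ?R
    then obtain k where "(oper M ^^ (k + i)) x = (oper M ^^ (k + j)) x" by blast
    then have "(oper M ^^ (n + (k + i))) x = (oper M ^^ (n + (k + j))) x" by (rule funpow_mono_eq)
    then have "(oper M ^^ ((k + i) + n)) x = (oper M ^^ ((k + j) + n)) x" by (simp only: ac_simps)
    then have "(oper M ^^ (k + i)) ((oper M ^^ n) x) = (oper M ^^ (k + j)) ((oper M ^^ n) x)"
      by (simp only: funpow_add comp_apply)
    then show ?L by blast
  qed
  then show ?thesis by (simp add: eventual_kernel_def)
qed

lemma eventual_kernel_linked:
  assumes "linked M x y"
  shows "eventual_kernel M x = eventual_kernel M y"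
  using assms eventual_kernel_iterate unfolding linked_def by metis

lemma kernel_subset_eventual_kernel: "kernel M x \<subseteq> eventual_kernel M x"
  unfolding kernel_def eventual_kernel_def by clarsimp (metis add_0)

lemma iterate_cyclic:
  assumes "monounary_algebra M" "x \<in> carrier M" "(oper M ^^ i) x = (oper M ^^ j) x" "i < j"
  shows "(oper M ^^ i) x \<in> cyclic_elements M"
proof -
  have "(oper M ^^ (j - i)) ((oper M ^^ i) x) = (oper M ^^ (j - i + i)) x"
    by (simp only: funpow_add comp_apply)
  also have "\<dots> = (oper M ^^ i) x" using assms(3,4) by simp
  finally show ?thesis
    using assms by (auto simp: cyclic_elements_def monounary_algebra_def intro!: funpow_closed exI[of _ "j - i"])
qed

text \<open>On a cycle steps can be undone by completing the round, so an eventual coincidence is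
  present from the start. Here too \<open>m * n\<close> is a multiple of the period that is at least
  n.\<close>

lemma eventual_kernel_cyclic:
  assumes "y \<in> cyclic_elements M"
  shows "eventual_kernel M y = kernel M y"
proof
  obtain m where m: "m \<ge> 1" "(oper M ^^ m) y = y" using assms by (auto simp: cyclic_elements_def)
  show "eventual_kernel M y \<subseteq> kernel M y"
  proof (clarsimp simp: eventual_kernel_def kernel_def)
    fix i j n assume eq: "(oper M ^^ (n + i)) y = (oper M ^^ (n + j)) y"
    have per: "(oper M ^^ (m * n + i)) y = (oper M ^^ i) y" for i
    proof -
      have "(oper M ^^ ((m * n + i) mod m)) y = (oper M ^^ (i mod m)) y" by simp
      then show ?thesis using funpow_mod_eq[OF m(2)] by metis
    qed
    have le: "m * n = (m * n - n) + n" using m(1) by simp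
    have "(oper M ^^ ((m * n - n) + (n + i))) y = (oper M ^^ ((m * n - n) + (n + j))) y"
      using eq by (rule funpow_mono_eq)
    then have "(oper M ^^ (m * n + i)) y = (oper M ^^ (m * n + j)) y" using le by (metis add.assoc)
    then show "(oper M ^^ i) y = (oper M ^^ j) y" by (simp only: per)
  qed
qed (rule kernel_subset_eventual_kernel)

text \<open>If two different iterates coincided, the earlier one would be cyclic.\<close>

lemma eventual_kernel_acyclic:
  assumes "monounary_algebra M" "x \<in> carrier M" "\<And>n. (oper M ^^ n) x \<notin> cyclic_elements M"
  shows "eventual_kernel M x = Id"
proof -
  have "i = j" if "(oper M ^^ (n + i)) x = (oper M ^^ (n + j)) x" for i j n
    using iterate_cyclic[OF assms(1,2) that] iterate_cyclic[OF assms(1,2) that[symmetric]] assms(3)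
    by (metis nat_add_left_cancel_less linorder_neqE_nat)
  then show ?thesis by (auto simp: eventual_kernel_def)
qed

lemma root:
  assumes "monounary_algebra M" "x \<in> carrier M"
  shows "root M x \<in> carrier M" "linked M x (root M x)" "kernel M (root M x) = eventual_kernel M x"
proof -
  have "\<exists>y. y \<in> carrier M \<and> linked M x y \<and> kernel M y = eventual_kernel M x"
  proof (cases "\<exists>n. (oper M ^^ n) x \<in> cyclic_elements M")
    case True
    then obtain n where n: "(oper M ^^ n) x \<in> cyclic_elements M" by blast
    then show ?thesis
      using eventual_kernel_cyclic[OF n] eventual_kernel_iterate[of M n x] linked_iterate[of M x n]
      by (auto simp: cyclic_elements_def)
  next
    case False
    then have "eventual_kernel M x = Id" using eventual_kernel_acyclic[OF assms] by simp
    moreover have "Id \<subseteq> kernel M x" by (auto simp: kernel_def)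
    ultimately have "kernel M x = eventual_kernel M x"
      using kernel_subset_eventual_kernel[of M x] by blast
    then show ?thesis using assms(2) by (intro exI[of _ x]) (simp add: linked_refl)
  qed
  from someI_ex[OF this] show "root M x \<in> carrier M" "linked M x (root M x)" "kernel M (root M x) = eventual_kernel M x"
    by (simp_all add: root_def)
qed

text \<open>Linked points give the very same predicate under the \<open>SOME\<close> of
  \<open>root\<close>, hence the same choice. So the roots form a transversal of the
  components.\<close>

lemma root_eq_iff:
  assumes "monounary_algebra M" "x \<in> carrier M" "y \<in> carrier M"
  shows "root M x = root M y \<longleftrightarrow> linked M x y"
proof
  assume "root M x = root M y"
  then show "linked M x y"
    using linked_trans[OF root(2)[OF assms(1,2)]] linked_sym[OF root(2)[OF assms(1,3)]] by simp
next
  assume xy: "linked M x y"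
  then have "linked M x = linked M y" by (auto intro: linked_sym linked_trans)
  then show "root M x = root M y" using eventual_kernel_linked[OF xy] by (simp add: root_def)
qed

lemma linked_roots_iff:
  assumes "monounary_algebra M" "x \<in> carrier M" "y \<in> carrier M"
  shows "linked M (root M x) y \<longleftrightarrow> root M x = root M y"
  using root[OF assms(1,2)] root_eq_iff[OF assms] by (metis linked_sym linked_trans)

lemma separated_roots:
  assumes "monounary_algebra M"
  shows "separated M (root M ` carrier M)"
proof (clarsimp simp: separated_def)
  fix x y assume xy: "x \<in> carrier M" "y \<in> carrier M" "linked M (root M x) (root M y)"
  then have "linked M (root M x) y"
    using linked_trans[OF xy(3) linked_sym[OF root(2)[OF assms]]] by simp
  then show "root M x = root M y" using linked_roots_iff[OF assms] xy by simp
qed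

section \<open>Ultrahomogeneity and branching\<close>

lemma bij_betw_fibers:
  assumes "bij_betw \<phi> A A'" "\<And>a. a \<in> A \<Longrightarrow> c' (\<phi> a) = c a"
  shows "bij_betw \<phi> {a \<in> A. c a = t} {a \<in> A'. c' a = t}"
  using assms by (fastforce simp: bij_betw_def inj_on_def image_iff)

text \<open>With kernels as colours this turns equal numbers of components for each kernel into a
  matching of roots that preserves kernels.\<close>

lemma bij_betw_from_fibers:
  assumes "\<And>t. |{b \<in> B. c b = t}| =o |{b \<in> B'. c' b = t}|"
  obtains \<sigma> where "bij_betw \<sigma> B B'" "\<And>b. b \<in> B \<Longrightarrow> c' (\<sigma> b) = c b"
proof -
  have "\<forall>t. \<exists>h. bij_betw h {b \<in> B. c b = t} {b \<in> B'. c' b = t}"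
    using assms by (simp add: card_of_ordIso)
  then obtain h where h: "\<And>t. bij_betw (h t) {b \<in> B. c b = t} {b \<in> B'. c' b = t}" by metis
  define \<sigma> where "\<sigma> b = h (c b) b" for b
  have \<sigma>: "\<sigma> b \<in> B'" "c' (\<sigma> b) = c b" if "b \<in> B" for b
    using h[of "c b"] that by (auto simp: \<sigma>_def bij_betw_def)
  have "inj_on \<sigma> B"
  proof (rule inj_onI)
    fix b b' assume b: "b \<in> B" "b' \<in> B" "\<sigma> b = \<sigma> b'"
    then have c: "c b = c b'" using \<sigma>(2) by metis
    then have "h (c b) b = h (c b) b'" using b(3) by (simp add: \<sigma>_def)
    moreover have "inj_on (h (c b)) {b' \<in> B. c b' = c b}" using h by (auto simp: bij_betw_def)
    ultimately show "b = b'" using b(1,2) c by (auto dest!: inj_onD)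
  qed
  moreover have "\<sigma> ` B = B'"
  proof (intro set_eqI iffI)
    fix y assume "y \<in> B'"
    then have "y \<in> h (c' y) ` {b \<in> B. c b = c' y}" using h[of "c' y"] by (auto simp: bij_betw_def)
    then obtain b where "b \<in> B" "y = \<sigma> b" unfolding \<sigma>_def by auto
    then show "y \<in> \<sigma> ` B" by blast
  qed (use \<sigma> in auto)
  ultimately show ?thesis using that \<sigma>(2) by (auto simp: bij_betw_def)
qed

text \<open>The last clause makes the image a union of connected components.\<close>

definition component_embedding :: "'a monounary \<Rightarrow> 'b monounary \<Rightarrow> ('a \<Rightarrow> 'b) \<Rightarrow> bool" where
  "component_embedding M N f \<longleftrightarrow> oper M ` carrier M \<subseteq> carrier M \<and>
     inj_on f (carrier M) \<and> f ` carrier M \<subseteq> carrier N \<and>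
     (\<forall>x\<in>carrier M. f (oper M x) = oper N (f x)) \<and>
     (\<forall>y\<in>carrier N. oper N y \<in> f ` carrier M \<longrightarrow> y \<in> f ` carrier M)"

lemma component_embeddingD:
  assumes "component_embedding M N f"
  shows "oper M ` carrier M \<subseteq> carrier M" "inj_on f (carrier M)"
    "\<And>x. x \<in> carrier M \<Longrightarrow> oper M x \<in> carrier M"
    "\<And>x. x \<in> carrier M \<Longrightarrow> f x \<in> carrier N"
    "\<And>x. x \<in> carrier M \<Longrightarrow> f (oper M x) = oper N (f x)"
    "\<And>y. y \<in> carrier N \<Longrightarrow> oper N y \<in> f ` carrier M \<Longrightarrow> y \<in> f ` carrier M"
  using assms by (auto simp: component_embedding_def)

lemma component_embedding_isomorphism:
  assumes "monounary_algebra M" "isomorphism M N f"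
  shows "component_embedding M N f"
  using assms by (auto simp: isomorphism_def component_embedding_def bij_betw_def monounary_algebra_def)

lemma component_embedding_kernel:
  assumes "component_embedding M N f" "x \<in> carrier M"
  shows "kernel N (f x) = kernel M x"
  using kernel_hom[of M "carrier M" f N x] component_embeddingD[OF assms(1)] assms(2) by simp

text \<open>Serves isomorphisms and the inclusions of a summand into a disjoint sum alike: closure
  under preimages leaves none of them outside the image, and preserved kernels preserve
  cyclicity.\<close>

lemma component_embedding_branch:
  assumes f: "component_embedding M N f" and x: "x \<in> carrier M"
  shows "f ` branch M x = branch N (f x)"
proof -
  note D = component_embeddingD[OF f]
  have cyc: "f z \<in> cyclic_elements N \<longleftrightarrow> z \<in> cyclic_elements M" if "z \<in> carrier M" for z
    using component_embedding_kernel[OF f that] that D(4) by (auto simp: mem_cyclic_iff_kernel)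
  show ?thesis
  proof (intro set_eqI iffI)
    fix w assume "w \<in> f ` branch M x"
    then obtain z where "w = f z" "z \<in> carrier M" "oper M z = x" "z \<notin> cyclic_elements M"
      by (auto simp: branch_iff)
    then show "w \<in> branch N (f x)" using D(4,5)[of z] cyc[of z] by (auto simp: branch_iff)
  next
    fix w assume w: "w \<in> branch N (f x)"
    then have "w \<in> f ` carrier M" using D(6)[of w] x by (simp add: branch_iff)
    then obtain z where z: "w = f z" "z \<in> carrier M" by blast
    then have "f (oper M z) = f x" using w D(5) by (simp add: branch_iff)
    then have "oper M z = x" using D(2) D(3)[OF z(2)] x by (simp add: inj_on_eq_iff)
    then show "w \<in> f ` branch M x" using z w cyc[OF z(2)] by (simp add: branch_iff)
  qed
qed

lemma component_embedding_card_branch: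
  assumes f: "component_embedding M N f" and x: "x \<in> carrier M"
  shows "|branch M x| =o |branch N (f x)|"
proof -
  have "inj_on f (branch M x)"
    using component_embeddingD(2)[OF f] by (rule inj_on_subset) (auto simp: branch_iff)
  then have "bij_betw f (branch M x) (branch N (f x))"
    using component_embedding_branch[OF assms] by (simp add: bij_betw_def)
  then show ?thesis using card_of_ordIso by blast
qed

lemma ultrahomogeneous_imp_alike:
  assumes alg: "monounary_algebra M" and uh: "ultrahomogeneous M"
  shows "alike M M"
  unfolding alike_def
proof (intro ballI impI)
  fix x y assume x: "x \<in> carrier M" and y: "y \<in> carrier M" and ker: "kernel M x = kernel M y"
  \<comment> \<open>Extending the empty map to the orbit of x gives the isomorphism of one-generated
    subalgebras that sends x to y.\<close>
  have "\<exists>f. iso_on M ({} \<union> orbits M {x}) M ({} \<union> orbits M {y}) f \<and> f x = y"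
    by (rule extend_to_orbits[of M "{}" M "{}" id "\<lambda>_. y" "{x}" "{y}"])
      (use ker in \<open>auto simp: subuniverse_def separated_def iso_on_iff bij_betw_def\<close>)
  then obtain f where f: "iso_on M (orbits M {x}) M (orbits M {y}) f" "f x = y" by auto
  have "fin_gen_subalgebra M (orbits M {x})" "fin_gen_subalgebra M (orbits M {y})"
    unfolding fin_gen_subalgebra_def
    by (rule exI[of _ "{x}"], use hull_eq_orbits[OF alg, of "{x}"] x in simp)
      (rule exI[of _ "{y}"], use hull_eq_orbits[OF alg, of "{y}"] y in simp)
  then obtain g where g: "isomorphism M M g" "\<And>z. z \<in> orbits M {x} \<Longrightarrow> g z = f z"
    using uh f(1) unfolding ultrahomogeneous_def by blast
  have "g x = y" using g(2)[of x] f(2) orbits_superset[of "{x}" M] by auto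
  then show "|branch M x| =o |branch M y|"
    using component_embedding_card_branch[OF component_embedding_isomorphism[OF alg g(1)] x] by simp
qed

text \<open>On components missed by \<open>S\<close> the map \<open>f\<close> says nothing. It does
  pair the components that meet \<open>S\<close> with those that meet \<open>T\<close>, finitely
  many and with equal root kernels; so for each kernel equally many components remain.\<close>

lemma alike_imp_ultrahomogeneous:
  assumes alg: "monounary_algebra M" and alike: "alike M M"
  shows "ultrahomogeneous M"
  unfolding ultrahomogeneous_def
proof (intro allI impI)
  fix S T f
  assume S: "fin_gen_subalgebra M S" and T: "fin_gen_subalgebra M T" and f: "iso_on M S M T f"
  let ?p = "oper M" and ?R = "root M ` carrier M"
  obtain X where X: "finite X" "X \<subseteq> carrier M" "S = orbits M X"
    using S alg hull_eq_orbits[OF alg] by (metis fin_gen_subalgebra_def)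
  obtain Y where Y: "Y \<subseteq> carrier M" "T = orbits M Y"
    using T alg hull_eq_orbits[OF alg] by (metis fin_gen_subalgebra_def)
  have subS: "subuniverse M S" and subT: "subuniverse M T"
    using subuniverse_orbits alg X Y by simp_all
  have Sc: "S \<subseteq> carrier M" and Tc: "T \<subseteq> carrier M" and Scl: "?p ` S \<subseteq> S"
    using subS subT by (auto simp: subuniverse_def)
  have fhom: "\<And>x. x \<in> S \<Longrightarrow> f (?p x) = ?p (f x)" and finj: "inj_on f S" and fim: "f ` S = T"
    using f by (auto simp: iso_on_iff bij_betw_def)
  have fpow: "f ((?p ^^ n) x) = (?p ^^ n) (f x)" if "x \<in> S" for n x
    using funpow_hom[of ?p S f ?p x] Scl fhom that by blast
  have flink: "linked M (f x) (f y) \<longleftrightarrow> linked M x y" if "x \<in> S" "y \<in> S" for x y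
  proof -
    have "(?p ^^ n) (f x) = (?p ^^ m) (f y) \<longleftrightarrow> (?p ^^ n) x = (?p ^^ m) y" for n m
      using that fpow funpow_closed[OF Scl] finj by (metis inj_onD)
    then show ?thesis by (simp add: linked_def)
  qed
  have fev: "eventual_kernel M (f x) = eventual_kernel M x" if "x \<in> S" for x
  proof -
    have "(?p ^^ n) (f x) = (?p ^^ m) (f x) \<longleftrightarrow> (?p ^^ n) x = (?p ^^ m) x" for n m
      using that fpow funpow_closed[OF Scl] finj by (metis inj_onD)
    then show ?thesis by (simp add: eventual_kernel_def)
  qed
  \<comment> \<open>The map induced by \<open>f\<close> on roots; the representative s is arbitrary
    because \<open>f\<close> preserves and reflects linkage.\<close>
  define \<phi> where "\<phi> r = root M (f (SOME s. s \<in> S \<and> root M s = r))" for r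
  have \<phi>: "\<phi> (root M s) = root M (f s)" if s: "s \<in> S" for s
  proof -
    define s' where "s' = (SOME s'. s' \<in> S \<and> root M s' = root M s)"
    have "s' \<in> S \<and> root M s' = root M s" unfolding s'_def by (rule someI[of _ s]) (use s in simp)
    then have s': "s' \<in> S" "linked M s' s" using root_eq_iff[OF alg] s Sc by blast+
    then have "root M (f s') = root M (f s)"
      using root_eq_iff[OF alg] flink[OF s'(1) s] fim Tc s by blast
    then show ?thesis by (simp add: \<phi>_def s'_def)
  qed
  have \<phi>bij: "bij_betw \<phi> (root M ` S) (root M ` T)"
  proof -
    have "inj_on \<phi> (root M ` S)"
    proof (clarsimp simp: inj_on_def \<phi>)
      fix s s' assume s: "s \<in> S" "s' \<in> S" "root M (f s) = root M (f s')"
      then have "f s \<in> carrier M" "f s' \<in> carrier M" using fim Tc by auto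
      then have "linked M s s'" using s flink root_eq_iff[OF alg] by simp
      then show "root M s = root M s'" using s Sc root_eq_iff[OF alg] by blast
    qed
    moreover have "\<phi> ` root M ` S = root M ` T" using \<phi> fim by (auto simp: image_image)
    ultimately show ?thesis by (simp add: bij_betw_def)
  qed
  have \<phi>ker: "kernel M (\<phi> r) = kernel M r" if r: "r \<in> root M ` S" for r
  proof -
    obtain s where s: "s \<in> S" "r = root M s" using r by blast
    then have "s \<in> carrier M" "f s \<in> carrier M" using Sc Tc fim by auto
    then show ?thesis using root(3)[OF alg] fev[OF s(1)] \<phi>[OF s(1)] s(2) by simp
  qed
  \<comment> \<open>Every point of \<open>S\<close> is linked to one of the finitely many
    generators.\<close>
  have finR: "finite (root M ` S)"
  proof -
    have "root M s \<in> root M ` X" if s: "s \<in> S" for s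
    proof -
      obtain x n where x: "x \<in> X" "s = (?p ^^ n) x" using s X(3) by (auto simp: orbits_def)
      then have "linked M s x" using linked_iterate linked_sym by metis
      then show ?thesis using root_eq_iff[OF alg, of s x] x s X(2) Sc by blast
    qed
    then have "root M ` S \<subseteq> root M ` X" by blast
    then show ?thesis using X(1) finite_subset by blast
  qed
  let ?B = "?R - root M ` S" and ?B' = "?R - root M ` T"
  have "|{b \<in> ?B. kernel M b = t}| =o |{b \<in> ?B'. kernel M b = t}|" for t
  proof -
    have "{b \<in> ?B. kernel M b = t} = {b \<in> ?R. kernel M b = t} - {b \<in> root M ` S. kernel M b = t}"
      "{b \<in> ?B'. kernel M b = t} = {b \<in> ?R. kernel M b = t} - {b \<in> root M ` T. kernel M b = t}"
      by auto
    moreover have "|{b \<in> ?R. kernel M b = t} - {b \<in> root M ` S. kernel M b = t}| =o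
      |{b \<in> ?R. kernel M b = t} - {b \<in> root M ` T. kernel M b = t}|"
    proof (rule ordIso_Diff_finite)
      show "bij_betw \<phi> {b \<in> root M ` S. kernel M b = t} {b \<in> root M ` T. kernel M b = t}"
        using \<phi>bij \<phi>ker by (rule bij_betw_fibers)
    qed (use Sc Tc finR card_of_refl in auto)
    ultimately show ?thesis by simp
  qed
  then obtain \<sigma> where \<sigma>: "bij_betw \<sigma> ?B ?B'" "\<And>b. b \<in> ?B \<Longrightarrow> kernel M (\<sigma> b) = kernel M b"
    by (rule bij_betw_from_fibers) blast
  have subR: "?R \<subseteq> carrier M" using root(1)[OF alg] by blast
  have sep: "separated M (?R - A)" for A
    using separated_roots[OF alg] unfolding separated_def by blast
  have sep': "\<not> linked M b s" if "U \<subseteq> carrier M" "b \<in> ?R - root M ` U" "s \<in> U" for U b s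
    using that linked_roots_iff[OF alg] by blast
  have cover: "\<exists>b\<in>U \<union> (?R - root M ` U). linked M x b" if "U \<subseteq> carrier M" "x \<in> carrier M" for U x
  proof (cases "root M x \<in> root M ` U")
    case True
    then obtain u where "u \<in> U" "root M x = root M u" by blast
    then show ?thesis using root_eq_iff[OF alg] that by blast
  next
    case False
    then show ?thesis using root(2)[OF alg] that(2) by blast
  qed
  show "\<exists>g. isomorphism M M g \<and> (\<forall>x\<in>S. g x = f x)"
  proof (rule extend_isomorphism[OF alg alg alike subS subT f, where B = ?B and B' = ?B' and \<sigma> = \<sigma>])
    show "finite (branch M x \<inter> S)" for x
      using finite_branch_orbits_finite[OF alg X(2,1)] X(3) by simp
    show "kernel M b = kernel M (\<sigma> b)" if "b \<in> ?B" for b using \<sigma>(2)[OF that] by simp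
    show "?B \<subseteq> carrier M" "?B' \<subseteq> carrier M" using subR by blast+
    show "bij_betw \<sigma> ?B ?B'" by (rule \<sigma>(1))
    show "separated M ?B" "separated M ?B'" by (rule sep)+
    show "\<not> linked M b s" if "b \<in> ?B" "s \<in> S" for b s using that by (rule sep'[OF Sc])
    show "\<not> linked M b s" if "b \<in> ?B'" "s \<in> T" for b s using that by (rule sep'[OF Tc])
    show "\<exists>b\<in>S \<union> ?B. linked M x b" if "x \<in> carrier M" for x using that by (rule cover[OF Sc])
    show "\<exists>b\<in>T \<union> ?B'. linked M x b" if "x \<in> carrier M" for x using that by (rule cover[OF Tc])
  qed blast
qed

section \<open>Lassos\<close>

text \<open>
  The kernel of an element of height \<open>h\<close> over a cycle of length \<open>n\<close>.
\<close>

definition lasso :: "nat \<Rightarrow> nat \<Rightarrow> (nat \<times> nat) set" where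
  "lasso n h = {(i, j). i = j \<or> h \<le> i \<and> h \<le> j \<and> (i - h) mod n = (j - h) mod n}"

lemma lasso_neq_Id: "n \<ge> 1 \<Longrightarrow> lasso n h \<noteq> Id"
proof -
  assume "n \<ge> 1"
  then have "(h, h + n) \<in> lasso n h" "(h, h + n) \<notin> Id" by (auto simp: lasso_def)
  then show ?thesis by metis
qed

text \<open>The pair \<open>(h, h + n)\<close> is the first repetition along the lasso; asking that
  it belong to the other lasso gives both claims.\<close>

lemma lasso_subset:
  assumes "n \<ge> 1" "lasso n h \<subseteq> lasso m g"
  shows "g \<le> h \<and> (g = h \<longrightarrow> m dvd n)"
proof -
  have "(h, h + n) \<in> lasso n h" by (simp add: lasso_def)
  then have "(h, h + n) \<in> lasso m g" using assms(2) by (rule rev_subsetD)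
  then show ?thesis using assms(1) by (auto simp: lasso_def)
qed

lemma lasso_eq_iff:
  assumes "n \<ge> 1" "m \<ge> 1"
  shows "lasso n h = lasso m g \<longleftrightarrow> n = m \<and> h = g"
  using lasso_subset[OF assms(1), of h m g] lasso_subset[OF assms(2), of g n h]
  by (auto intro: dvd_antisym)

lemma cyclic_iterate:
  assumes "monounary_algebra M" "c \<in> cyclic_elements M"
  shows "(oper M ^^ k) c \<in> cyclic_elements M"
proof -
  obtain m where m: "m \<ge> 1" "(oper M ^^ m) c = c" and c: "c \<in> carrier M"
    using assms(2) by (auto simp: cyclic_elements_def)
  have "(oper M ^^ k) c = (oper M ^^ (k + m)) c" using m(2) by (simp add: funpow_add)
  then show ?thesis using iterate_cyclic[OF assms(1) c] m(1) by simp
qed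

lemma kernel_cyclic:
  assumes "c \<in> cyclic_elements M"
  obtains n where "n \<ge> 1" "kernel M c = lasso n 0"
proof -
  let ?p = "oper M"
  define n where "n = (LEAST n. n \<ge> 1 \<and> (?p ^^ n) c = c)"
  have ex: "\<exists>n. n \<ge> 1 \<and> (?p ^^ n) c = c" using assms by (auto simp: cyclic_elements_def)
  have n: "n \<ge> 1" "(?p ^^ n) c = c" unfolding n_def using LeastI_ex[OF ex] by blast+
  have min: "(?p ^^ k) c \<noteq> c" if "1 \<le> k" "k < n" for k
    using not_less_Least[of k "\<lambda>n. n \<ge> 1 \<and> (?p ^^ n) c = c"] that n_def by blast
  have neq: "(?p ^^ a) c \<noteq> (?p ^^ b) c" if "a < b" "b < n" for a b
  proof
    assume "(?p ^^ a) c = (?p ^^ b) c"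
    \<comment> \<open>\<open>n - b\<close> more steps bring the later point back to c, so the
      earlier one would give the shorter period \<open>n - b + a\<close>.\<close>
    then have "(?p ^^ (n - b + a)) c = (?p ^^ (n - b + b)) c" by (rule funpow_mono_eq)
    then have "(?p ^^ (n - b + a)) c = c" using n(2) that by simp
    moreover have "1 \<le> n - b + a" "n - b + a < n" using that by auto
    ultimately show False using min by blast
  qed
  have "(?p ^^ i) c = (?p ^^ j) c \<longleftrightarrow> i mod n = j mod n" for i j
  proof -
    have "(?p ^^ i) c = (?p ^^ (i mod n)) c" "(?p ^^ j) c = (?p ^^ (j mod n)) c"
      using funpow_mod_eq[OF n(2)] by simp_all
    then show ?thesis using neq[of "i mod n" "j mod n"] neq[of "j mod n" "i mod n"] n(1)
      by (metis linorder_neqE_nat mod_less_divisor less_eq_Suc_le One_nat_def)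
  qed
  then have "kernel M c = lasso n 0" by (auto simp: kernel_def lasso_def)
  then show ?thesis using that n(1) by blast
qed

text \<open>Links the period seen by the kernel to the number of cyclic elements, which is what
  \<open>is_A\<close> prescribes.\<close>

lemma card_orbit_cyclic:
  assumes "kernel M c = lasso n 0" "n \<ge> 1"
  shows "card (orbits M {c}) = n"
proof -
  have eq: "(oper M ^^ i) c = (oper M ^^ j) c \<longleftrightarrow> i mod n = j mod n" for i j
  proof -
    have "(i, j) \<in> kernel M c \<longleftrightarrow> i mod n = j mod n" unfolding assms(1) by (auto simp: lasso_def)
    then show ?thesis by (simp add: kernel_def)
  qed
  have "orbits M {c} = (\<lambda>i. (oper M ^^ i) c) ` {..<n}"
  proof (intro set_eqI iffI)
    fix x assume "x \<in> orbits M {c}"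
    then obtain i where "x = (oper M ^^ i) c" by (auto simp: orbits_def)
    then have "x = (oper M ^^ (i mod n)) c" using eq[of i "i mod n"] by simp
    then show "x \<in> (\<lambda>i. (oper M ^^ i) c) ` {..<n}" using assms(2) by simp
  qed (auto simp: orbits_def)
  moreover have "inj_on (\<lambda>i. (oper M ^^ i) c) {..<n}" by (auto simp: inj_on_def eq)
  ultimately show ?thesis by (simp add: card_image)
qed

lemma kernel_height:
  assumes "monounary_algebra M" "x \<in> carrier M" "height M x = enat h"
  shows "(oper M ^^ h) x \<in> cyclic_elements M"
    and "kernel M ((oper M ^^ h) x) = lasso n 0 \<Longrightarrow> kernel M x = lasso n h"
proof -
  have ex: "\<exists>n. (oper M ^^ n) x \<in> cyclic_elements M"
    and h: "h = (LEAST n. (oper M ^^ n) x \<in> cyclic_elements M)"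
    using assms(3) by (auto simp: height_def split: if_splits)
  show "(oper M ^^ h) x \<in> cyclic_elements M" unfolding h using ex by (rule LeastI_ex)
  assume ker: "kernel M ((oper M ^^ h) x) = lasso n 0"
  have min: "h \<le> k" if "(oper M ^^ k) x \<in> cyclic_elements M" for k
    unfolding h using that by (rule Least_le)
  \<comment> \<open>Of two coinciding iterates the earlier one is cyclic, so neither exponent lies
    below the height.\<close>
  have late: "h \<le> i \<and> h \<le> j" if "(i, j) \<in> kernel M x" "i \<noteq> j" for i j
    using that iterate_cyclic[OF assms(1,2), of i j] iterate_cyclic[OF assms(1,2), of j i] min[of i] min[of j]
    by (cases i j rule: linorder_cases) (auto simp: kernel_def)
  have shift: "(i, j) \<in> kernel M x \<longleftrightarrow> (i - h) mod n = (j - h) mod n" if "h \<le> i" "h \<le> j" for i j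
  proof -
    have "(i, j) \<in> kernel M x \<longleftrightarrow> (i - h, j - h) \<in> kernel M ((oper M ^^ h) x)"
      using that by (simp add: kernel_iterate)
    then show ?thesis unfolding ker by (auto simp: lasso_def)
  qed
  have "(i, j) \<in> kernel M x \<longleftrightarrow> (i, j) \<in> lasso n h" for i j
    using late[of i j] shift[of i j] by (auto simp: lasso_def) (simp_all add: kernel_def)
  then show "kernel M x = lasso n h" by auto
qed

lemma height_infinite_kernel:
  assumes "monounary_algebra M" "x \<in> carrier M" "height M x = \<infinity>"
  shows "kernel M x = Id"
proof -
  have "eventual_kernel M x = Id"
    using assms by (intro eventual_kernel_acyclic) (auto simp: height_def split: if_splits)
  moreover have "Id \<subseteq> kernel M x" by (auto simp: kernel_def)
  ultimately show ?thesis using kernel_subset_eventual_kernel[of M x] by blast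
qed

lemma kernel_cases:
  assumes "monounary_algebra M" "x \<in> carrier M"
  obtains "kernel M x = Id" | n h where "n \<ge> 1" "kernel M x = lasso n h"
proof (cases "height M x")
  case (enat h)
  obtain n where "n \<ge> 1" "kernel M ((oper M ^^ h) x) = lasso n 0"
    using kernel_cyclic[OF kernel_height(1)[OF assms enat]] .
  then show ?thesis using that(2) kernel_height(2)[OF assms enat] by blast
next
  case infinity
  then show ?thesis by (intro that(1) height_infinite_kernel[OF assms])
qed

text \<open>The kernel of a root equals its eventual kernel, so the repetition
  \<open>(h, h + n)\<close> can be pulled back to \<open>(0, n)\<close>, which forces h = 0.\<close>

lemma kernel_root_cases:
  assumes "monounary_algebra M" "b \<in> root M ` carrier M"
  obtains "kernel M b = Id" | n where "n \<ge> 1" "kernel M b = lasso n 0"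
proof -
  obtain x where x: "x \<in> carrier M" "b = root M x" using assms(2) by blast
  then have b: "b \<in> carrier M" "eventual_kernel M b = kernel M b"
    using root[OF assms(1) x(1)] eventual_kernel_linked[OF root(2)[OF assms(1) x(1)]] x(2) by simp_all
  show ?thesis
  proof (rule kernel_cases[OF assms(1) b(1)])
    fix n h assume nh: "n \<ge> 1" "kernel M b = lasso n h"
    have "(h + 0, h + n) \<in> kernel M b" unfolding nh(2) by (simp add: lasso_def)
    then have "(0, n) \<in> eventual_kernel M b" unfolding kernel_def eventual_kernel_def by blast
    then have "(0, n) \<in> lasso n h" using b(2) nh(2) by simp
    then have "h = 0" using nh(1) by (auto simp: lasso_def)
    then show ?thesis using that(2) nh by blast
  qed (rule that(1))
qed

section \<open>Sums of the canonical algebras\<close>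

lemma is_B_kernel_branch:
  assumes "is_B \<alpha> M" "x \<in> carrier M"
  shows "kernel M x = Id" "|branch M x| =o \<alpha>"
proof -
  have "height M x = \<infinity>" using assms(1) by (simp add: is_B_def height_def)
  then show "kernel M x = Id" using assms by (intro height_infinite_kernel) (simp_all add: is_B_def)
  show "|branch M x| =o \<alpha>" using assms by (simp add: is_B_def branch_def)
qed

text \<open>By connectedness the cyclic elements form a single orbit, so their number n is the
  period. The height is the index into the list; the last clause fixes it for base points on the
  cycle.\<close>

lemma is_A_kernel_branch:
  assumes A: "is_A n \<alpha>s M" and n: "n \<ge> 1" and x: "x \<in> carrier M"
  obtains h where "kernel M x = lasso n h" "|branch M x| =o \<alpha>s h" "x \<in> cyclic_elements M \<Longrightarrow> h = 0"
proof -
  let ?C = "cyclic_elements M"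
  have alg: "monounary_algebra M" and con: "connected_algebra M" and card: "card ?C = n"
    using A by (auto simp: is_A_def)
  have cycker: "kernel M c = lasso n 0" if c: "c \<in> ?C" for c
  proof -
    have cc: "c \<in> carrier M" using c by (simp add: cyclic_elements_def)
    have sub: "subuniverse M (orbits M {c})" using subuniverse_orbits[OF alg] cc by simp
    have "\<exists>k. (oper M ^^ k) y \<in> orbits M {c}" if y: "y \<in> carrier M" for y
    proof -
      obtain k l where "(oper M ^^ k) y = (oper M ^^ l) c"
        using con y cc unfolding connected_algebra_def by blast
      then have "(oper M ^^ k) y \<in> orbits M {c}" by (auto simp: orbits_def)
      then show ?thesis by blast
    qed
    then have "?C \<subseteq> orbits M {c}" by (rule cyclic_subset_subuniverse[OF sub])
    moreover have "orbits M {c} \<subseteq> ?C" using cyclic_iterate[OF alg c] by (auto simp: orbits_def)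
    ultimately have "orbits M {c} = ?C" by blast
    moreover obtain m where m: "m \<ge> 1" "kernel M c = lasso m 0" using kernel_cyclic[OF c] .
    ultimately have "m = n" using card_orbit_cyclic[OF m(2,1)] card by simp
    then show ?thesis using m by simp
  qed
  have "?C \<noteq> {}" using card n by auto
  then obtain c where c: "c \<in> ?C" by blast
  then have "c \<in> carrier M" by (simp add: cyclic_elements_def)
  then obtain k l where kl: "(oper M ^^ k) x = (oper M ^^ l) c"
    using con x unfolding connected_algebra_def by blast
  then have ex: "\<exists>k. (oper M ^^ k) x \<in> ?C" using cyclic_iterate[OF alg c, of l] by metis
  define h where "h = (LEAST k. (oper M ^^ k) x \<in> ?C)"
  have ht: "height M x = enat h" using ex by (simp add: height_def h_def)
  have ker: "kernel M x = lasso n h"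
    using kernel_height(2)[OF alg x ht] cycker[OF kernel_height(1)[OF alg x ht]] by blast
  have h0: "h = 0" if "x \<in> ?C"
    unfolding h_def using that by (intro Least_eq_0) simp
  have "|branch M x| =o \<alpha>s h"
  proof (cases "h = 0")
    case True
    then have "x \<in> ?C" using kernel_height(1)[OF alg x ht] by simp
    then show ?thesis using A True by (simp add: is_A_def branch_def)
  next
    case False
    have "z \<notin> ?C" if z: "z \<in> preimages M x" for z
    proof
      assume zc: "z \<in> ?C"
      then obtain m where m: "m \<ge> 1" "(oper M ^^ m) z = z" by (auto simp: cyclic_elements_def)
      have "(oper M ^^ m) x = (oper M ^^ Suc m) z"
        using z by (simp add: preimages_def funpow_Suc_right del: funpow.simps)
      also have "\<dots> = x" using m(2) z by (simp add: preimages_def)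
      finally have "x \<in> ?C" using x m(1) by (auto simp: cyclic_elements_def)
      then show False using h0 False by blast
    qed
    then have "branch M x = preimages M x" by (auto simp: branch_def)
    then show ?thesis using A False x ht by (simp add: is_A_def)
  qed
  then show ?thesis using that ker h0 by blast
qed

lemma linked_component_embedding:
  assumes "component_embedding M N f" "x \<in> carrier M" "y \<in> carrier M" "linked M x y"
  shows "linked N (f x) (f y)"
proof -
  have "f ((oper M ^^ n) z) = (oper N ^^ n) (f z)" if "z \<in> carrier M" for n z
    using funpow_hom[of "oper M" "carrier M" f "oper N" z] component_embeddingD[OF assms(1)] that by simp
  then show ?thesis using assms(2-4) unfolding linked_def by metis
qed

text \<open>The image is closed under preimages, so a point whose orbit enters it was there already.
  This keeps the summands of a disjoint sum apart.\<close>

lemma linked_in_component_embedding: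
  assumes f: "component_embedding M N f" and alg: "monounary_algebra N"
    and "x \<in> carrier M" "y \<in> carrier N" "linked N (f x) y"
  shows "y \<in> f ` carrier M"
proof -
  note D = component_embeddingD[OF f]
  obtain n m where nm: "(oper N ^^ n) (f x) = (oper N ^^ m) y" using assms(5) by (auto simp: linked_def)
  have "(oper N ^^ n) (f x) = f ((oper M ^^ n) x)"
    using funpow_hom[of "oper M" "carrier M" f "oper N" x] D assms(3) by simp
  also have "\<dots> \<in> f ` carrier M" using funpow_closed[OF D(1) assms(3)] by blast
  finally have "(oper N ^^ m) y \<in> f ` carrier M" using nm by simp
  with alg \<open>y \<in> carrier N\<close> show ?thesis
  proof (induction rule: reach_induct)
    case (step z)
    then show ?case using D(6) by simp
  qed
qed

section \<open>The sums of the theorem, their branching and their multiplicities\<close>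

definition canonical_sum ::
  "(nat \<Rightarrow> nat) \<Rightarrow> 'c rel \<Rightarrow> (nat \<Rightarrow> 'c rel) \<Rightarrow> 'c rel \<Rightarrow> (nat \<Rightarrow> nat \<Rightarrow> 'c rel) \<Rightarrow>
    ('c \<times> nat \<times> 'c list + nat \<times> 'c \<times> nat \<times> 'c list) monounary" where
  "canonical_sum n \<beta> \<beta>s \<alpha> \<alpha>s =
     \<beta> \<odot> B_alg \<alpha> \<oplus> indexed_sum {1..} (\<lambda>k. \<beta>s k \<odot> A_alg (n k) (\<alpha>s k))"

definition branching ::
  "(nat \<Rightarrow> nat) \<Rightarrow> 'c rel \<Rightarrow> (nat \<Rightarrow> nat \<Rightarrow> 'c rel) \<Rightarrow> 'a monounary \<Rightarrow> bool" where
  "branching n \<alpha> \<alpha>s M \<longleftrightarrow> (\<forall>x\<in>carrier M. kernel M x = Id \<and> |branch M x| =o \<alpha> \<or>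
     (\<exists>k\<ge>1. \<exists>h. kernel M x = lasso (n k) h \<and> |branch M x| =o \<alpha>s k h))"

text \<open>A kernel identifies its entry in the data: \<open>Id\<close> is no lasso, and a lasso
  returns its cycle length and height. Distinctness of the cycle lengths then recovers k, so equal
  kernels refer to one cardinal.\<close>

lemma branching_imp_alike:
  fixes M :: "'a monounary" and N :: "'b monounary" and \<alpha> :: "'c rel"
  assumes n: "inj_on n {1..}" "\<forall>k\<ge>1. n k \<ge> 1" and "branching n \<alpha> \<alpha>s M" "branching n \<alpha> \<alpha>s N"
  shows "alike M N"
  unfolding alike_def
proof (intro ballI impI)
  fix x y assume xy: "x \<in> carrier M" "y \<in> carrier N" "kernel M x = kernel N y"
  have common: "|branch M x| =o |branch N y|" if "|branch M x| =o r" "|branch N y| =o r" for r :: "'c rel"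
    using ordIso_transitive[OF that(1) ordIso_symmetric[OF that(2)]] .
  consider "kernel M x = Id" "|branch M x| =o \<alpha>"
    | k h where "k \<ge> 1" "kernel M x = lasso (n k) h" "|branch M x| =o \<alpha>s k h"
    using assms(3) xy(1) unfolding branching_def by blast
  moreover have y: "kernel N y = Id \<and> |branch N y| =o \<alpha> \<or>
      (\<exists>k\<ge>1. \<exists>h. kernel N y = lasso (n k) h \<and> |branch N y| =o \<alpha>s k h)"
    using assms(4) xy(2) unfolding branching_def by blast
  moreover have no: "lasso (n k) h \<noteq> Id" if "k \<ge> 1" for k h
    using n(2) that lasso_neq_Id by blast
  ultimately show "|branch M x| =o |branch N y|"
  proof cases
    case 1
    then have "|branch N y| =o \<alpha>"
      using y xy(3) no by metis
    then show ?thesis by (rule common[OF 1(2)])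
  next
    case (2 k h)
    then obtain l g where l: "l \<ge> 1" "kernel N y = lasso (n l) g" "|branch N y| =o \<alpha>s l g"
      using y xy(3) no by metis
    have "lasso (n k) h = lasso (n l) g" using 2(2) l(2) xy(3) by (simp only:)
    moreover have "n k \<ge> 1" "n l \<ge> 1" using n(2) 2(1) l(1) by blast+
    ultimately have eq: "n k = n l" "h = g" using lasso_eq_iff by blast+
    moreover have "k = l" using inj_onD[OF n(1) eq(1)] 2(1) l(1) by simp
    ultimately show ?thesis using 2(3) l(3) by (intro common[of "\<alpha>s k h"]) simp_all
  qed
qed

lemma branching_isomorphism:
  fixes M :: "'a monounary" and N :: "'b monounary" and \<alpha> :: "'c rel"
  assumes "monounary_algebra M" "isomorphism M N f" "branching n \<alpha> \<alpha>s N"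
  shows "branching n \<alpha> \<alpha>s M"
  unfolding branching_def
proof
  fix x assume x: "x \<in> carrier M"
  have f: "component_embedding M N f" by (rule component_embedding_isomorphism[OF assms(1,2)])
  have tr: "|branch M x| =o r" if "|branch N (f x)| =o r" for r :: "'c rel"
    using ordIso_transitive[OF component_embedding_card_branch[OF f x] that] .
  have "f x \<in> carrier N" using component_embeddingD(4)[OF f x] .
  then show "kernel M x = Id \<and> |branch M x| =o \<alpha> \<or>
     (\<exists>k\<ge>1. \<exists>h. kernel M x = lasso (n k) h \<and> |branch M x| =o \<alpha>s k h)"
    using assms(3) tr component_embedding_kernel[OF f x] unfolding branching_def by metis
qed

locale canonical =
  fixes n :: "nat \<Rightarrow> nat" and \<beta> :: "'c rel" and \<beta>s :: "nat \<Rightarrow> 'c rel" and \<alpha> :: "'c rel"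
    and \<alpha>s :: "nat \<Rightarrow> nat \<Rightarrow> 'c rel"
  assumes n1: "k \<ge> 1 \<Longrightarrow> n k \<ge> 1" and \<alpha>: "nonzero_cardinal \<alpha>"
    and \<alpha>s: "k \<ge> 1 \<Longrightarrow> nonzero_cardinal_list (\<alpha>s k)"
begin

abbreviation "N \<equiv> canonical_sum n \<beta> \<beta>s \<alpha> \<alpha>s"
abbreviation "A k \<equiv> A_alg (n k) (\<alpha>s k)"

lemma is_B: "is_B \<alpha> (B_alg \<alpha>)"
  using \<alpha> by (rule is_B_B_alg)

lemma is_A:
  assumes "k \<ge> 1"
  shows "is_A (n k) (\<alpha>s k) (A k)"
proof (rule is_A_A_alg[OF n1[OF assms]])
  fix j
  obtain L :: enat where "\<forall>j. if enat j < L then nonzero_cardinal (\<alpha>s k j)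
      else Card_order (\<alpha>s k j) \<and> Field (\<alpha>s k j) = {}"
    using \<alpha>s[OF assms] unfolding nonzero_cardinal_list_def by blast
  then show "Card_order (\<alpha>s k j)"
    unfolding nonzero_cardinal_def by (metis (full_types))
qed

lemma B_closed: "x \<in> carrier (B_alg \<alpha>) \<Longrightarrow> oper (B_alg \<alpha>) x \<in> carrier (B_alg \<alpha>)"
  using is_B by (auto simp: is_B_def monounary_algebra_def)

lemma A_closed: "k \<ge> 1 \<Longrightarrow> x \<in> carrier (A k) \<Longrightarrow> oper (A k) x \<in> carrier (A k)"
  using is_A[of k] by (auto simp: is_A_def monounary_algebra_def)

lemma carrier_cases:
  assumes "y \<in> carrier N"
  obtains i x where "i \<in> Field \<beta>" "x \<in> carrier (B_alg \<alpha>)" "y = Inl (i, x)"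
  | k i x where "k \<ge> 1" "i \<in> Field (\<beta>s k)" "x \<in> carrier (A k)" "y = Inr (k, i, x)"
  using assms by (auto simp: canonical_sum_def binary_sum_def copies_def indexed_sum_def)

lemma embedding_B:
  assumes "i \<in> Field \<beta>"
  shows "component_embedding (B_alg \<alpha>) N (\<lambda>x. Inl (i, x))"
  using assms B_closed
  by (auto simp: component_embedding_def canonical_sum_def binary_sum_def copies_def indexed_sum_def inj_on_def)

lemma embedding_A:
  assumes "k \<ge> 1" "i \<in> Field (\<beta>s k)"
  shows "component_embedding (A k) N (\<lambda>x. Inr (k, i, x))"
  using assms A_closed
  by (auto simp: component_embedding_def canonical_sum_def binary_sum_def copies_def indexed_sum_def inj_on_def)

lemma closed: "y \<in> carrier N \<Longrightarrow> oper N y \<in> carrier N"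
  using B_closed A_closed
  by (auto simp: canonical_sum_def binary_sum_def copies_def indexed_sum_def)

lemma branching: "branching n \<alpha> \<alpha>s N"
  unfolding branching_def
proof
  fix y assume "y \<in> carrier N"
  then show "kernel N y = Id \<and> |branch N y| =o \<alpha> \<or>
    (\<exists>k\<ge>1. \<exists>h. kernel N y = lasso (n k) h \<and> |branch N y| =o \<alpha>s k h)"
  proof (cases rule: carrier_cases)
    case (1 i x)
    note e = embedding_B[OF 1(1)]
    have "kernel N y = Id"
      using component_embedding_kernel[OF e 1(2)] is_B_kernel_branch(1)[OF is_B 1(2)] 1(3) by simp
    moreover have "|branch N y| =o \<alpha>"
      using ordIso_transitive[OF ordIso_symmetric[OF component_embedding_card_branch[OF e 1(2)]]
          is_B_kernel_branch(2)[OF is_B 1(2)]] 1(3) by simp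
    ultimately show ?thesis by blast
  next
    case (2 k i x)
    note e = embedding_A[OF 2(1,2)]
    obtain h where h: "kernel (A k) x = lasso (n k) h" "|branch (A k) x| =o \<alpha>s k h"
      using is_A_kernel_branch[OF is_A[OF 2(1)] n1[OF 2(1)] 2(3)] by metis
    have "kernel N y = lasso (n k) h"
      using component_embedding_kernel[OF e 2(3)] h(1) 2(4) by simp
    moreover have "|branch N y| =o \<alpha>s k h"
      using ordIso_transitive[OF ordIso_symmetric[OF component_embedding_card_branch[OF e 2(3)]] h(2)] 2(4)
      by simp
    ultimately show ?thesis using 2(1) by blast
  qed
qed

text \<open>The multiplicities are the sets of roots themselves, so the copy with index
  \<open>\<iota> b\<close> stands for the component of the root b. Sending each root to a base point
  of its copy starts the extension.\<close>

lemma isomorphic_if_counts: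
  assumes alg: "monounary_algebra M" and inj: "inj_on n {1..}" and br: "branching n \<alpha> \<alpha>s M"
    and \<iota>: "inj_on \<iota> (carrier M)"
    and \<beta>: "Field \<beta> = \<iota> ` {b \<in> root M ` carrier M. kernel M b = Id}"
    and \<beta>s: "\<And>k. k \<ge> 1 \<Longrightarrow> Field (\<beta>s k) = \<iota> ` {b \<in> root M ` carrier M. kernel M b = lasso (n k) 0}"
    and types: "\<And>b. b \<in> root M ` carrier M \<Longrightarrow> kernel M b = Id \<or> (\<exists>k\<ge>1. kernel M b = lasso (n k) 0)"
  shows "isomorphic M N"
proof -
  let ?R = "root M ` carrier M"
  have R: "?R \<subseteq> carrier M" using root(1)[OF alg] by blast
  have \<iota>R: "b = b'" if "b \<in> ?R" "b' \<in> ?R" "\<iota> b = \<iota> b'" for b b'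
    using that R \<iota> by (meson inj_onD subsetD)
  have "carrier (B_alg \<alpha>) \<noteq> {}" using is_B by (simp add: is_B_def monounary_algebra_def)
  then obtain b0 where b0: "b0 \<in> carrier (B_alg \<alpha>)" by blast
  \<comment> \<open>Base points of \<open>A k\<close> are taken on the cycle, where the kernel is
    \<open>lasso (n k) 0\<close> as for a root; in \<open>B_alg \<alpha>\<close> any point will do,
    all kernels being \<open>Id\<close>.\<close>
  have "\<exists>c. c \<in> cyclic_elements (A k)" if "k \<ge> 1" for k
  proof -
    have "card (cyclic_elements (A k)) \<ge> 1" using is_A[OF that] n1[OF that] by (simp add: is_A_def)
    then have "cyclic_elements (A k) \<noteq> {}" by auto
    then show ?thesis by blast
  qed
  then obtain c where cyc: "\<And>k. k \<ge> 1 \<Longrightarrow> c k \<in> cyclic_elements (A k)" by metis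
  have c: "c k \<in> carrier (A k)" if "k \<ge> 1" for k using cyc[OF that] by (simp add: cyclic_elements_def)
  have kerc: "kernel (A k) (c k) = lasso (n k) 0" if k: "k \<ge> 1" for k
    using is_A_kernel_branch[OF is_A[OF k] n1[OF k] c[OF k]] cyc[OF k] by metis
  define K where "K b = (SOME k. k \<ge> 1 \<and> kernel M b = lasso (n k) 0)" for b
  have K: "K b \<ge> 1 \<and> kernel M b = lasso (n (K b)) 0" if "b \<in> ?R" "kernel M b \<noteq> Id" for b
    unfolding K_def by (rule someI_ex) (use types that in auto)
  have Keq: "K b = k" if "b \<in> ?R" "k \<ge> 1" "kernel M b = lasso (n k) 0" for b k
  proof -
    have "kernel M b \<noteq> Id" using that lasso_neq_Id[OF n1] by simp
    then have "K b \<ge> 1" "lasso (n (K b)) 0 = lasso (n k) 0" using K[OF that(1)] that(3) by auto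
    then have "n (K b) = n k" using lasso_eq_iff[of "n (K b)" "n k" 0 0] n1 that(2) by simp
    then show ?thesis using inj \<open>K b \<ge> 1\<close> that(2) by (simp add: inj_on_eq_iff)
  qed
  define \<sigma> where "\<sigma> b = (if kernel M b = Id then Inl (\<iota> b, b0) else Inr (K b, \<iota> b, c (K b)))" for b
  \<comment> \<open>The last clause says that the component of \<open>\<sigma> b\<close> carries the
    index \<open>\<iota> b\<close>; separation of the base points then follows from injectivity of
    \<open>\<iota>\<close>.\<close>
  have \<sigma>mem: "\<sigma> b \<in> carrier N \<and> kernel N (\<sigma> b) = kernel M b \<and>
      (\<forall>y\<in>carrier N. linked N (\<sigma> b) y \<longrightarrow> (\<exists>x. y = Inl (\<iota> b, x)) \<or> (\<exists>k x. y = Inr (k, \<iota> b, x)))"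
    if b: "b \<in> ?R" and algN: "monounary_algebra N" for b
  proof (cases "kernel M b = Id")
    case True
    then have "\<iota> b \<in> Field \<beta>" using b \<beta> by blast
    note e = embedding_B[OF this]
    have "kernel N (\<sigma> b) = kernel M b"
      using component_embedding_kernel[OF e b0] is_B_kernel_branch(1)[OF is_B b0] True by (simp add: \<sigma>_def)
    moreover have "\<exists>x. y = Inl (\<iota> b, x)" if "y \<in> carrier N" "linked N (\<sigma> b) y" for y
      using linked_in_component_embedding[OF e algN b0 that(1)] that(2) True by (auto simp: \<sigma>_def)
    ultimately show ?thesis using component_embeddingD(4)[OF e b0] True by (simp add: \<sigma>_def)
  next
    case False
    let ?k = "K b"
    have k: "?k \<ge> 1" "kernel M b = lasso (n ?k) 0" using K[OF b False] by auto
    then have "\<iota> b \<in> Field (\<beta>s ?k)" using b \<beta>s[OF k(1)] by blast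
    note e = embedding_A[OF k(1) this]
    have "kernel N (\<sigma> b) = kernel M b"
      using component_embedding_kernel[OF e c[OF k(1)]] kerc[OF k(1)] k(2) False by (simp add: \<sigma>_def)
    moreover have "\<exists>k x. y = Inr (k, \<iota> b, x)" if "y \<in> carrier N" "linked N (\<sigma> b) y" for y
      using linked_in_component_embedding[OF e algN c[OF k(1)] that(1)] that(2) False by (auto simp: \<sigma>_def)
    ultimately show ?thesis using component_embeddingD(4)[OF e c[OF k(1)]] False by (simp add: \<sigma>_def)
  qed
  have cover: "\<exists>b\<in>?R. linked N y (\<sigma> b)" if "y \<in> carrier N" for y
    using that
  proof (cases rule: carrier_cases)
    case (1 i x)
    then obtain b where b: "b \<in> ?R" "kernel M b = Id" "i = \<iota> b" using \<beta> by blast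
    have "linked (B_alg \<alpha>) x b0"
      using is_B 1(2) b0 by (auto simp: is_B_def connected_algebra_def linked_def)
    then have "linked N y (\<sigma> b)"
      using linked_component_embedding[OF embedding_B[OF 1(1)] 1(2) b0] 1(3) b by (simp add: \<sigma>_def)
    then show ?thesis using b(1) by blast
  next
    case (2 k i x)
    then obtain b where b: "b \<in> ?R" "kernel M b = lasso (n k) 0" "i = \<iota> b" using \<beta>s[OF 2(1)] by blast
    have "linked (A k) x (c k)"
      using is_A[OF 2(1)] 2(3) c[OF 2(1)] by (auto simp: is_A_def connected_algebra_def linked_def)
    then have "linked N y (\<sigma> b)"
      using linked_component_embedding[OF embedding_A[OF 2(1,2)] 2(3) c[OF 2(1)]] 2(4) b
        Keq[OF b(1) 2(1) b(2)] lasso_neq_Id[OF n1[OF 2(1)]] by (simp add: \<sigma>_def)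
    then show ?thesis using b(1) by blast
  qed
  \<comment> \<open>The sum would be empty if all multiplicities were zero; a root of the nonempty M
    prevents this.\<close>
  have "carrier N \<noteq> {}"
  proof -
    obtain x where "x \<in> carrier M" using alg by (auto simp: monounary_algebra_def)
    then have x: "root M x \<in> ?R" by blast
    then consider "kernel M (root M x) = Id" | k where "k \<ge> 1" "kernel M (root M x) = lasso (n k) 0"
      using types by blast
    then show ?thesis
    proof cases
      case 1
      then have "\<iota> (root M x) \<in> Field \<beta>" using x \<beta> by blast
      then show ?thesis using component_embeddingD(4)[OF embedding_B b0] by blast
    next
      case 2
      then have "\<iota> (root M x) \<in> Field (\<beta>s k)" using x \<beta>s by blast
      then show ?thesis using component_embeddingD(4)[OF embedding_A[OF 2(1)] c[OF 2(1)]] by blast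
    qed
  qed
  then have algN: "monounary_algebra N" using closed by (auto simp: monounary_algebra_def)
  note \<sigma> = \<sigma>mem[OF _ algN]
  have \<sigma>sep: "b = b'" if "b \<in> ?R" "b' \<in> ?R" "linked N (\<sigma> b) (\<sigma> b')" for b b'
  proof -
    have "\<sigma> b' \<in> carrier N" using \<sigma>[OF that(2)] by blast
    then have "(\<exists>x. \<sigma> b' = Inl (\<iota> b, x)) \<or> (\<exists>k x. \<sigma> b' = Inr (k, \<iota> b, x))"
      using \<sigma>[OF that(1)] that(3) by blast
    then have "\<iota> b = \<iota> b'" by (auto simp: \<sigma>_def split: if_splits)
    then show ?thesis using \<iota>R that(1,2) by blast
  qed
  have "\<exists>g. isomorphism M N g"
  \<comment> \<open>Between empty subuniverses every function is an isomorphism, hence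
    \<open>undefined\<close>.\<close>
  proof (rule extend_isomorphism[of M N "{}" "{}" undefined ?R "\<sigma> ` ?R" \<sigma>])
    show "alike M N" using branching_imp_alike[OF inj _ br branching] n1 by blast
    show "bij_betw \<sigma> ?R (\<sigma> ` ?R)"
    proof (rule bij_betw_imageI[OF inj_onI refl])
      fix b b' assume "b \<in> ?R" "b' \<in> ?R" "\<sigma> b = \<sigma> b'"
      then show "b = b'" using \<sigma>sep[of b b'] linked_refl[of N "\<sigma> b"] by simp
    qed
    show "kernel M b = kernel N (\<sigma> b)" if "b \<in> ?R" for b using \<sigma>[OF that] by simp
    show "separated M ?R" by (rule separated_roots[OF alg])
    show "separated N (\<sigma> ` ?R)" unfolding separated_def
    proof (intro ballI impI)
      fix y y' assume y: "y \<in> \<sigma> ` ?R" "y' \<in> \<sigma> ` ?R" "linked N y y'"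
      then obtain b b' where "b \<in> ?R" "b' \<in> ?R" "y = \<sigma> b" "y' = \<sigma> b'" by blast
      then show "y = y'" using \<sigma>sep[of b b'] y(3) by simp
    qed
    show "\<sigma> ` ?R \<subseteq> carrier N" using \<sigma> by blast
    show "\<exists>b\<in>{} \<union> ?R. linked M x b" if "x \<in> carrier M" for x
      using root(2)[OF alg that] that by blast
    show "\<exists>b\<in>{} \<union> \<sigma> ` ?R. linked N y b" if "y \<in> carrier N" for y
      using cover[OF that] by blast
  qed (use alg algN R in \<open>auto simp: subuniverse_def iso_on_iff bij_betw_def\<close>)
  then show ?thesis by (simp add: isomorphic_def)
qed

end

text \<open>All cycle lengths are listed, the k-th being k, and those that do not occur get
  multiplicity zero. The injection \<open>\<iota>\<close> moves the cardinals found in M to the type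
  'c.\<close>

lemma alike_imp_isomorphic_canonical_sum:
  fixes M :: "'a monounary"
  assumes alg: "monounary_algebra M" and al: "alike M M" and le: "|carrier M| \<le>o |UNIV :: 'c set|"
  obtains \<beta> :: "'c rel" and \<beta>s :: "nat \<Rightarrow> 'c rel" and \<alpha> :: "'c rel" and \<alpha>s :: "nat \<Rightarrow> nat \<Rightarrow> 'c rel"
  where "Card_order \<beta>" "\<forall>k\<ge>1. Card_order (\<beta>s k)" "nonzero_cardinal \<alpha>"
    "\<forall>k\<ge>1. nonzero_cardinal_list (\<alpha>s k)" "isomorphic M (canonical_sum (\<lambda>k. k) \<beta> \<beta>s \<alpha> \<alpha>s)"
proof -
  obtain \<iota> :: "'a \<Rightarrow> 'c" where \<iota>: "inj_on \<iota> (carrier M)" using le unfolding card_of_ordLeq[symmetric] by blast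
  define P where "P t x \<longleftrightarrow> x \<in> carrier M \<and> kernel M x = t" for t x
  \<comment> \<open>The common branch size of all elements with kernel t, and zero if there are
    none, so that lists end where the heights do.\<close>
  define \<kappa> where "\<kappa> t = (if \<exists>x. P t x then |\<iota> ` branch M (SOME x. P t x)| else |{}| )" for t
  have \<kappa>: "|branch M x| =o \<kappa> t" if x: "P t x" for x t
  proof -
    define y where "y = (SOME y. P t y)"
    have y: "P t y" unfolding y_def using x by (rule someI)
    have "|branch M x| =o |branch M y|" using al x y by (auto simp: alike_def P_def)
    moreover have "inj_on \<iota> (branch M y)" using \<iota> by (rule inj_on_subset) (auto simp: branch_iff)
    then have "|branch M y| =o |\<iota> ` branch M y|" using card_of_ordIso by (metis bij_betw_imageI)
    ultimately have "|branch M x| =o |\<iota> ` branch M y|" by (rule ordIso_transitive)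
    moreover have "\<kappa> t = |\<iota> ` branch M y|" using x by (auto simp: \<kappa>_def y_def)
    ultimately show ?thesis by simp
  qed
  have \<kappa>card: "Card_order (\<kappa> t)" for t by (simp add: \<kappa>_def card_of_Card_order)
  have \<kappa>empty: "Field (\<kappa> t) = {} \<longleftrightarrow> branch M x = {}" if "P t x" for t x
  proof -
    have "|branch M x| =o |Field (\<kappa> t)|"
      using ordIso_transitive[OF \<kappa>[OF that] ordIso_symmetric[OF card_of_Field_ordIso[OF \<kappa>card]]] .
    then show ?thesis by (metis card_of_empty3 card_of_ordIso_finite ordIso_symmetric card_of_ordIso bij_betw_empty1 bij_betw_empty2)
  qed
  have pred: "z \<in> branch M (oper M z) \<and> oper M z \<in> carrier M"
    if "z \<in> carrier M" "z \<notin> cyclic_elements M" for z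
    using that alg by (auto simp: branch_iff monounary_algebra_def)
  \<comment> \<open>Without an element of kernel \<open>Id\<close> the multiplicity is zero, but a
    nonzero cardinal is still required; the full type supplies one.\<close>
  define \<alpha> where "\<alpha> = (if \<exists>x. P Id x then \<kappa> Id else |UNIV :: 'c set| )"
  define \<alpha>s where "\<alpha>s k h = \<kappa> (lasso k h)" for k h
  let ?R = "root M ` carrier M"
  define \<beta> where "\<beta> = |\<iota> ` {b \<in> ?R. kernel M b = Id}|"
  define \<beta>s where "\<beta>s k = |\<iota> ` {b \<in> ?R. kernel M b = lasso k 0}|" for k
  \<comment> \<open>An element of kernel \<open>Id\<close> is itself a noncyclic preimage of its
    image, which again has kernel \<open>Id\<close>.\<close>
  have \<alpha>1: "nonzero_cardinal \<alpha>"
  proof (cases "\<exists>x. P Id x")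
    case True
    then obtain x where x: "x \<in> carrier M" "kernel M x = Id" by (auto simp: P_def)
    then have "x \<notin> cyclic_elements M" by (auto simp: mem_cyclic_iff_kernel)
    note p = pred[OF x(1) this]
    have "(i, j) \<in> kernel M (oper M x) \<longleftrightarrow> (i + 1, j + 1) \<in> kernel M x" for i j
      using kernel_iterate[of i j M 1 x] by simp
    then have "kernel M (oper M x) = Id" using x(2) by auto
    then have "Field (\<kappa> Id) \<noteq> {}" using p \<kappa>empty[of Id "oper M x"] by (auto simp: P_def)
    then show ?thesis using True \<kappa>card by (simp add: \<alpha>_def nonzero_cardinal_def)
  next
    case False
    then have "\<alpha> = |UNIV :: 'c set|" by (simp only: \<alpha>_def if_False)
    moreover have "Card_order |UNIV :: 'c set|" by (rule card_of_Card_order)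
    moreover have "Field |UNIV :: 'c set| \<noteq> {}" by (simp add: Field_card_of)
    ultimately show ?thesis by (simp only: nonzero_cardinal_def simp_thms)
  qed
  \<comment> \<open>A nonzero entry at \<open>Suc h\<close> comes from an existing element of that
    height, and this element is a noncyclic preimage of one of height h. Hence the nonzero entries
    form an initial segment.\<close>
  have step: "Field (\<alpha>s k h) \<noteq> {}" if ne: "Field (\<alpha>s k (Suc h)) \<noteq> {}" and k: "k \<ge> 1" for k h
  proof -
    obtain x where x: "x \<in> carrier M" "kernel M x = lasso k (Suc h)"
      using ne by (auto simp: \<alpha>s_def \<kappa>_def P_def Field_card_of split: if_splits)
    then have "x \<notin> cyclic_elements M" by (auto simp: mem_cyclic_iff_kernel lasso_def)
    note p = pred[OF x(1) this]
    have "(i, j) \<in> kernel M (oper M x) \<longleftrightarrow> (i + 1, j + 1) \<in> kernel M x" for i j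
      using kernel_iterate[of i j M 1 x] by simp
    then have "kernel M (oper M x) = lasso k h" using x(2) by (auto simp: lasso_def)
    then show ?thesis using p \<kappa>empty[of "lasso k h" "oper M x"] by (auto simp: P_def \<alpha>s_def)
  qed
  have \<alpha>s1: "nonzero_cardinal_list (\<alpha>s k)" if k: "k \<ge> 1" for k
  proof -
    \<comment> \<open>The position of the first zero entry, if any; by \<open>down\<close> nothing
      nonzero follows it.\<close>
    define L where "L = (if \<exists>h. Field (\<alpha>s k h) = {} then enat (LEAST h. Field (\<alpha>s k h) = {}) else \<infinity>)"
    have down: "Field (\<alpha>s k h) \<noteq> {}" if "Field (\<alpha>s k h') \<noteq> {}" "h \<le> h'" for h h'
      using that(2,1) by (induction h' rule: dec_induct) (use step k in auto)
    have "Field (\<alpha>s k h) \<noteq> {} \<longleftrightarrow> enat h < L" for h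
    proof (cases "\<exists>h. Field (\<alpha>s k h) = {}")
      case True
      let ?l = "LEAST h. Field (\<alpha>s k h) = {}"
      have "Field (\<alpha>s k ?l) = {}" using True by (rule LeastI_ex)
      then have "Field (\<alpha>s k h) \<noteq> {} \<longleftrightarrow> h < ?l"
        using not_less_Least[of h "\<lambda>h. Field (\<alpha>s k h) = {}"] down[of h ?l] down[of ?l h] by force
      then show ?thesis using True by (simp add: L_def)
    qed (simp add: L_def)
    then show ?thesis
      unfolding nonzero_cardinal_list_def nonzero_cardinal_def
      by (intro exI[of _ L]) (auto simp: \<alpha>s_def \<kappa>card)
  qed
  interpret canonical "\<lambda>k. k" \<beta> \<beta>s \<alpha> \<alpha>s
    by unfold_locales (use \<alpha>1 \<alpha>s1 in auto)
  have br: "branching (\<lambda>k. k) \<alpha> \<alpha>s M"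
    unfolding branching_def
  proof
    fix x assume x: "x \<in> carrier M"
    show "kernel M x = Id \<and> |branch M x| =o \<alpha> \<or> (\<exists>k\<ge>1. \<exists>h. kernel M x = lasso k h \<and> |branch M x| =o \<alpha>s k h)"
    proof (rule kernel_cases[OF alg x])
      assume "kernel M x = Id"
      then have "P Id x" using x by (simp add: P_def)
      then show ?thesis using \<kappa>[of Id x] \<open>kernel M x = Id\<close> by (auto simp: \<alpha>_def)
    next
      fix k h assume "k \<ge> 1" "kernel M x = lasso k h"
      then show ?thesis using x \<kappa>[of "lasso k h" x] by (auto simp: \<alpha>s_def P_def)
    qed
  qed
  have "isomorphic M N"
  proof (rule isomorphic_if_counts[OF alg _ br \<iota>])
    fix b assume "b \<in> ?R"
    then show "kernel M b = Id \<or> (\<exists>k\<ge>1. kernel M b = lasso k 0)"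
      using kernel_root_cases[OF alg] by metis
  qed (simp_all add: \<beta>_def \<beta>s_def Field_card_of)
  then show ?thesis
    using that[of \<beta> \<beta>s \<alpha> \<alpha>s] \<alpha>1 \<alpha>s1 by (simp add: \<beta>_def \<beta>s_def card_of_Card_order)
qed

(* Cardinals are taken over an arbitrary type 'c with at least as many elements as the algebra;
   for instance, 'c may be 'a itself. *)

theorem theorem4p10:
  fixes M :: "'a monounary"
  assumes "monounary_algebra M"
    and "|carrier M| \<le>o |UNIV :: 'c set|"
  shows "ultrahomogeneous M \<longleftrightarrow>
    (\<exists>(n :: nat \<Rightarrow> nat) (\<beta> :: 'c rel) (\<beta>s :: nat \<Rightarrow> 'c rel) (\<alpha> :: 'c rel)
       (\<alpha>s :: nat \<Rightarrow> nat \<Rightarrow> 'c rel).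
       inj_on n {1..} \<and> (\<forall>k\<ge>1. n k \<ge> 1) \<and>
       Card_order \<beta> \<and> (\<forall>k\<ge>1. Card_order (\<beta>s k)) \<and> nonzero_cardinal \<alpha> \<and>
       (\<forall>k\<ge>1. nonzero_cardinal_list (\<alpha>s k)) \<and>
       isomorphic M (\<beta> \<odot> B_alg \<alpha> \<oplus> indexed_sum {1..} (\<lambda>k. \<beta>s k \<odot> A_alg (n k) (\<alpha>s k))))"
    (is "_ \<longleftrightarrow> ?R")
proof
  assume "ultrahomogeneous M"
  then have "alike M M" by (rule ultrahomogeneous_imp_alike[OF assms(1)])
  then obtain \<beta> :: "'c rel" and \<beta>s :: "nat \<Rightarrow> 'c rel" and \<alpha> :: "'c rel" and \<alpha>s :: "nat \<Rightarrow> nat \<Rightarrow> 'c rel"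
    where "Card_order \<beta>" "\<forall>k\<ge>1. Card_order (\<beta>s k)" "nonzero_cardinal \<alpha>"
      "\<forall>k\<ge>1. nonzero_cardinal_list (\<alpha>s k)" "isomorphic M (canonical_sum (\<lambda>k. k) \<beta> \<beta>s \<alpha> \<alpha>s)"
    by (rule alike_imp_isomorphic_canonical_sum[OF assms(1) _ assms(2)])
  then show ?R
    unfolding canonical_sum_def by (intro exI[of _ "\<lambda>k. k"] exI conjI) auto
next
  assume ?R
  then obtain n \<beta> \<beta>s \<alpha> and \<alpha>s :: "nat \<Rightarrow> nat \<Rightarrow> 'c rel" where n: "inj_on n {1..}" "\<forall>k\<ge>1. n k \<ge> 1"
    and \<alpha>: "nonzero_cardinal \<alpha>" "\<forall>k\<ge>1. nonzero_cardinal_list (\<alpha>s k)"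
    and iso: "isomorphic M (canonical_sum n \<beta> \<beta>s \<alpha> \<alpha>s)"
    unfolding canonical_sum_def by blast
  interpret canonical n \<beta> \<beta>s \<alpha> \<alpha>s
    using n \<alpha> by unfold_locales auto
  obtain f where "isomorphism M N f" using iso by (auto simp: isomorphic_def)
  then have "branching n \<alpha> \<alpha>s M" using branching_isomorphism[OF assms(1) _ branching] by blast
  then have "alike M M" by (intro branching_imp_alike[OF n])
  then show "ultrahomogeneous M" by (rule alike_imp_ultrahomogeneous[OF assms(1)])
qed

end
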